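(* Let $d\ge2$ and let $\mu_1,\dots,\mu_r>-1$ be such that $\mu_i-\mu_j\notin\mathbb Z$ if $i\neq j$. Let $\vec n=(n_1,\dots,n_r),\ \vec j=(j_1,\dots,j_r)\in\mathbb N_0^r$ be such that $0\le|\vec j|\le|\vec n|/2$. Let $\mathbf a=(a_1,\dots,a_d),\ \mathbf m=(m_1,\dots,m_d)\in\mathbb N_0^d$ be such that $|\mathbf m|=|\vec n|-2|\vec j|$ and $m_d\in\{0,1\}$, and write $\mathbf x^{\mathbf a}=x_1^{a_1}\cdots x_d^{a_d}$. Consider the Type I polynomials $\mathbf A^{\vec n}_{\vec j,\mathbf m,(1)},\dots,\mathbf A^{\vec n}_{\vec j,\mathbf m,(r)}$ on the ball. Then $$\sum_{l=1}^r\langle\mathbf A^{\vec n}_{\vec j,\mathbf m,(l)}(\mathbf x),\mathbf x^{\mathbf a}\rangle_l=\int_{B^d}\sum_{l=1}^r\mathbf A^{\vec n}_{\vec j,\mathbf m,(l)}(\mathbf x)\,\mathbf x^{\mathbf a}\,W_l(\mathbf x)\,d\mathbf x=0\qquad\text{if }0\le|\mathbf a|<|\vec n|-2 .$$ Moreover, this quantity also vanishes if $a_{d-k}+\cdots+a_d<m_{d-k}+\cdots+m_d$, or $a_{d-k}+\cdots+a_d-(m_{d-k}+\cdots+m_d)$ is an odd positive integer, for some $k\in\{1,\dots,d-1\}$.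
   Context: For a vector $v$ of nonnegative integers, $|v|$ is the sum of its components. $B^d=\{\mathbf x\in\mathbb R^d:\|\mathbf x\|\le1\}$ is the unit ball. Write $\vec\mu=(\mu_1,\dots,\mu_r)$, $W_l(\mathbf x)=w_{\mu_l}(1-\|\mathbf x\|^2)^{\mu_l}$ with the normalization constant $w_\mu=\Gamma(\mu+1+\tfrac d2)/(\pi^{d/2}\Gamma(\mu+1))$, and $\langle f,g\rangle_l=\int_{B^d}f(\mathbf x)g(\mathbf x)W_l(\mathbf x)\,d\mathbf x$. Spherical polar coordinates $\mathbf x\equiv(\rho,\theta_1,\dots,\theta_{d-1})$: $x_1=\rho\cos\theta_{d-1}$, $x_2=\rho\sin\theta_{d-1}\cos\theta_{d-2}$, …, $x_{d-1}=\rho\sin\theta_{d-1}\cdots\sin\theta_2\cos\theta_1$, $x_d=\rho\sin\theta_{d-1}\cdots\sin\theta_2\sin\theta_1$, with $0\le\rho\le1$, $0\le\theta_1<2\pi$, $0\le\theta_k\le\pi$ for $k=2,\dots,d-1$. Spherical harmonics: for $\mathbf m\in\mathbb N_0^d$ with $|\mathbf m|=M$, $m_d\in\{0,1\}$, $$Y^M_{\mathbf m}(\rho,\theta_1,\dots,\theta_{d-1})=\rho^M g(\theta_1)\prod_{k=1}^{d-2}\Big[(\sin\theta_{d-k})^{\beta_k}C^{\lambda_k}_{m_k}(\cos\theta_{d-k})\Big],$$ where $g(\theta_1)=\cos((m_{d-1}+m_d)\theta_1)$ if $m_d=0$, $g(\theta_1)=\sin((m_{d-1}+m_d)\theta_1)$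 if $m_d=1$, $\beta_k=\sum_{i=k+1}^dm_i$, $\lambda_k=\beta_k+(d-k-1)/2$, and $C^{\lambda}_m$ is the Gegenbauer polynomial of degree $m$, orthogonal on $[-1,1]$ for the weight $(1-t^2)^{\lambda-1/2}$. Type I Jacobi–Piñeiro polynomials: for $\alpha>-1$ and $\vec k\in\mathbb N_0^r$, $(A^{(\alpha,\vec\mu)}_{\vec k,1},\dots,A^{(\alpha,\vec\mu)}_{\vec k,r})$ is the vector of univariate polynomials with $\deg A^{(\alpha,\vec\mu)}_{\vec k,l}\le k_l-1$ (so the $l$-th one is $0$ if $k_l=0$) and $$\sum_{l=1}^r \int_0^1A^{(\alpha,\vec\mu)}_{\vec k,l}(t)\,t^s\,t^{\alpha}(1-t)^{\mu_l}\,dt=\begin{cases}0&\text{if }0\le s\le|\vec k|-2,\\1&\text{if }s=|\vec k|-1.\end{cases}$$ Type I multiple orthogonal polynomials on the ball: with $M=|\vec n|-2|\vec j|$ and $1\le l\le r$, $$\mathbf A^{\vec n}_{\vec j,\mathbf m,(l)}(\mathbf x)=A^{(M+(d-2)/2,\vec\mu)}_{\vec j,l}(\rho^2)\,Y^M_{\mathbf m}(\rho,\theta_1,\dots,\theta_{d-1}),$$ which is a polynomial in $(x_1,\dots,x_d)$.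
   Formalization: The vanishing for |a|<|n|-2 is proved with the l-th polynomial divided by w_{mu_l} (equivalently, w_{mu_l} dropped from W_l); as stated it fails: d=r=2, mu=(0,1/2), n=(2,2), j=(1,1), m=a=0 gives -5. The other claims are proved for the literal polynomials too. *)

theory Defs
  imports "HOL-Analysis.Analysis" "HOL-Computational_Algebra.Polynomial"
begin

text \<open>
  A point of \<open>\<real>\<^sup>d\<close> is a function of type \<open>nat \<Rightarrow> real\<close> whose coordinates are its values
  at \<open>1, \<dots>, d\<close>; Lebesgue measure is the product measure over \<open>{1..d}\<close>. Multi-indices are
  functions of type \<open>nat \<Rightarrow> nat\<close>, read on \<open>{1..d}\<close> or \<open>{1..r}\<close>.
\<close>

definition msize :: "nat \<Rightarrow> (nat \<Rightarrow> nat) \<Rightarrow> nat" where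
  "msize N v = (\<Sum>i = 1..N. v i)"

definition leb :: "nat \<Rightarrow> (nat \<Rightarrow> real) measure" where
  "leb d = Pi\<^sub>M {1..d} (\<lambda>_. lborel)"

definition unit_ball :: "nat \<Rightarrow> (nat \<Rightarrow> real) set" where
  "unit_ball d = {x \<in> space (leb d). L2_set x {1..d} \<le> 1}"

definition ball_const :: "nat \<Rightarrow> real \<Rightarrow> real" where
  "ball_const d \<mu> = Gamma (\<mu> + 1 + real d / 2) / (pi powr (real d / 2) * Gamma (\<mu> + 1))"

definition ball_weight :: "nat \<Rightarrow> real \<Rightarrow> (nat \<Rightarrow> real) \<Rightarrow> real" where
  "ball_weight d \<mu> x = ball_const d \<mu> * (1 - (L2_set x {1..d})\<^sup>2) powr \<mu>"

definition ball_inner ::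
  "nat \<Rightarrow> real \<Rightarrow> ((nat \<Rightarrow> real) \<Rightarrow> real) \<Rightarrow> ((nat \<Rightarrow> real) \<Rightarrow> real) \<Rightarrow> real" where
  "ball_inner d \<mu> f g = (LINT x:unit_ball d|leb d. f x * g x * ball_weight d \<mu> x)"

definition monomial_fun :: "nat \<Rightarrow> (nat \<Rightarrow> nat) \<Rightarrow> (nat \<Rightarrow> real) \<Rightarrow> real" where
  "monomial_fun d a x = (\<Prod>i = 1..d. x i ^ a i)"

definition polar_point :: "nat \<Rightarrow> real \<Rightarrow> (nat \<Rightarrow> real) \<Rightarrow> nat \<Rightarrow> real" where
  "polar_point d \<rho> \<theta> i =
     \<rho> * (\<Prod>k = d - i + 1..d - 1. sin (\<theta> k)) * (if i < d then cos (\<theta> (d - i)) else 1)"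

definition is_polar :: "nat \<Rightarrow> (nat \<Rightarrow> real) \<Rightarrow> real \<Rightarrow> (nat \<Rightarrow> real) \<Rightarrow> bool" where
  "is_polar d x \<rho> \<theta> \<longleftrightarrow>
     0 \<le> \<rho> \<and> 0 \<le> \<theta> 1 \<and> \<theta> 1 < 2 * pi \<and> (\<forall>k\<in>{2..d - 1}. 0 \<le> \<theta> k \<and> \<theta> k \<le> pi) \<and>
     (\<forall>i\<in>{1..d}. x i = polar_point d \<rho> \<theta> i)"

text \<open>
  Polar coordinates are not unique on a null set (for example at the origin). The functions
  below take the same value at every admissible choice, so the selection is harmless.
\<close>

definition polar_of :: "nat \<Rightarrow> (nat \<Rightarrow> real) \<Rightarrow> real \<times> (nat \<Rightarrow> real)" where
  "polar_of d x = (SOME (\<rho>, \<theta>). is_polar d x \<rho> \<theta>)"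

text \<open>
  The Gegenbauer polynomial, up to its (irrelevant) normalization.
\<close>

definition is_gegenbauer :: "real \<Rightarrow> nat \<Rightarrow> real poly \<Rightarrow> bool" where
  "is_gegenbauer lam n p \<longleftrightarrow> p \<noteq> 0 \<and> degree p = n \<and>
     (\<forall>q. degree q < n \<longrightarrow>
        (LBINT t:{-1..1}. poly p t * poly q t * (1 - t\<^sup>2) powr (lam - 1 / 2)) = 0)"

definition sph_beta :: "nat \<Rightarrow> (nat \<Rightarrow> nat) \<Rightarrow> nat \<Rightarrow> nat" where
  "sph_beta d m k = (\<Sum>i = k + 1..d. m i)"

definition sph_lambda :: "nat \<Rightarrow> (nat \<Rightarrow> nat) \<Rightarrow> nat \<Rightarrow> real" where
  "sph_lambda d m k = real (sph_beta d m k) + (real d - real k - 1) / 2"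

definition sph_harm ::
  "(real \<Rightarrow> nat \<Rightarrow> real poly) \<Rightarrow> nat \<Rightarrow> (nat \<Rightarrow> nat) \<Rightarrow> real \<Rightarrow> (nat \<Rightarrow> real) \<Rightarrow> real" where
  "sph_harm C d m \<rho> \<theta> =
     \<rho> ^ msize d m *
     (if m d = 0 then cos (real (m (d - 1) + m d) * \<theta> 1)
      else sin (real (m (d - 1) + m d) * \<theta> 1)) *
     (\<Prod>k = 1..d - 2. sin (\<theta> (d - k)) ^ sph_beta d m k *
        poly (C (sph_lambda d m k) (m k)) (cos (\<theta> (d - k))))"

text \<open>
  Type I Jacobi-Pineiro vectors. For \<open>k l = 0\<close> the first condition says \<open>A l = 0\<close>,
  for \<open>k l > 0\<close> it says that the degree of \<open>A l\<close> is at most \<open>k l - 1\<close>.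
\<close>

definition jacobi_pineiro_typeI ::
  "nat \<Rightarrow> real \<Rightarrow> (nat \<Rightarrow> real) \<Rightarrow> (nat \<Rightarrow> nat) \<Rightarrow> (nat \<Rightarrow> real poly) \<Rightarrow> bool" where
  "jacobi_pineiro_typeI r \<alpha> \<mu> k A \<longleftrightarrow>
     (\<forall>l\<in>{1..r}. A l = 0 \<or> degree (A l) < k l) \<and>
     (\<forall>s. s + 1 \<le> msize r k \<longrightarrow>
        (\<Sum>l = 1..r. LBINT t:{0..1}. poly (A l) t * t ^ s * t powr \<alpha> * (1 - t) powr \<mu> l)
          = (if s + 1 = msize r k then 1 else 0))"

text \<open>
  The function \<open>x \<mapsto> p(\<rho>\<^sup>2) Y(\<rho>, \<theta>)\<close> on the ball, where \<open>p\<close> is a component of a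
  Jacobi-Pineiro vector.
\<close>

definition ball_typeI ::
  "(real \<Rightarrow> nat \<Rightarrow> real poly) \<Rightarrow> nat \<Rightarrow> real poly \<Rightarrow> (nat \<Rightarrow> nat) \<Rightarrow> (nat \<Rightarrow> real) \<Rightarrow> real" where
  "ball_typeI C d p m x = (case polar_of d x of (\<rho>, \<theta>) \<Rightarrow> poly p (\<rho>\<^sup>2) * sph_harm C d m \<rho> \<theta>)"

text \<open>
  The moment conditions on a Jacobi-Pineiro vector are for the weights \<open>t\<^sup>\<alpha> (1 - t) powr \<mu> l\<close>,
  whereas \<open>ball_weight d (\<mu> l)\<close> carries the constant \<open>ball_const d (\<mu> l)\<close>, which depends on \<open>l\<close>.
  Dividing the \<open>l\<close>-th component by this constant gives the vector whose moment conditions are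
  for the weights with the constants. Without it the moments of low degree do not cancel: for
  \<open>d = r = 2\<close>, \<open>\<mu> = (0, 1/2)\<close>, \<open>n = (2, 2)\<close>, \<open>j = (1, 1)\<close>, \<open>m = a = (0, 0)\<close> the components are
  the constants \<open>10\<close> and \<open>-15\<close>, and the sum of the inner products is \<open>-5\<close>.
\<close>

definition ball_typeI_norm ::
  "(real \<Rightarrow> nat \<Rightarrow> real poly) \<Rightarrow> nat \<Rightarrow> real \<Rightarrow> real poly \<Rightarrow> (nat \<Rightarrow> nat) \<Rightarrow> (nat \<Rightarrow> real) \<Rightarrow> real" where
  "ball_typeI_norm C d \<mu> p m x = ball_typeI C d p m x / ball_const d \<mu>"

end

theory Submission
  imports Defs
begin

text \<open>
  With \<open>r\<^sub>k = sqrt (x\<^sub>k\<^sup>2 + \<dots> + x\<^sub>d\<^sup>2)\<close> the spherical harmonic is the product of the factors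
  \<open>r\<^sub>k ^ m\<^sub>k * C (x\<^sub>k / r\<^sub>k)\<close>, \<open>1 \<le> k \<le> d - 2\<close>, and the real or imaginary part of a power of
  \<open>x\<^sub>d\<^sub>-\<^sub>1 + \<i> x\<^sub>d\<close>. Integrating out \<open>x\<^sub>d, x\<^sub>d\<^sub>-\<^sub>1, \<dots>, x\<^sub>1\<close> in this order, each step replaces a radial
  function of \<open>(x\<^sub>k, \<dots>, x\<^sub>d)\<close> by a one-dimensional radial integral times a constant: in the half
  plane of the pairs \<open>(x\<^sub>k, r\<^sub>k\<^sub>+\<^sub>1)\<close> the substitution \<open>y = R * u / sqrt (1 + u\<^sup>2)\<close>, \<open>t = R / sqrt (1 + u\<^sup>2)\<close>
  separates the variables, and it is a composition of linear substitutions in one variable, so no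
  surface measure is needed. The constant of step \<open>k\<close> is a Gegenbauer moment (for the last two
  coordinates, the integral of a trigonometric polynomial over the circle), which vanishes by
  orthogonality or by parity as soon as \<open>a\<^sub>k + \<dots> + a\<^sub>d < m\<^sub>k + \<dots> + m\<^sub>d\<close> or the difference is odd.
  What remains is a radial integral; if \<open>|a| = |m| + 2 q\<close>, the substitution \<open>t = \<rho>\<^sup>2\<close> turns it
  into the \<open>q\<close>-th Jacobi-Pineiro moment.
\<close>

section \<open>The gnomonic substitution on a half plane\<close>

lemma nn_integral_gnomonic:
  fixes G :: "real \<Rightarrow> real \<Rightarrow> ennreal"
  assumes G[measurable]: "case_prod G \<in> borel_measurable (borel \<Otimes>\<^sub>M borel)"
  shows "(\<integral>\<^sup>+t. indicator {0<..} t * (\<integral>\<^sup>+y. G y t \<partial>lborel) \<partial>lborel) =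
    (\<integral>\<^sup>+u. \<integral>\<^sup>+R. ennreal (indicator {0<..} R * (R / (1 + u\<^sup>2))) *
       G (R * u / sqrt (1 + u\<^sup>2)) (R / sqrt (1 + u\<^sup>2)) \<partial>lborel \<partial>lborel)"
proof -
  have pos: "0 < 1 + u\<^sup>2" for u :: real
    by (simp add: add_pos_nonneg)
  have scale_y: "indicator {0<..} t * (\<integral>\<^sup>+y. G y t \<partial>lborel) =
      (\<integral>\<^sup>+u. ennreal (indicator {0<..} t * t) * G (t * u) t \<partial>lborel)" for t :: real
  proof (cases "t > 0")
    case True
    have "(\<lambda>y. G y t) \<in> borel_measurable borel"
      by measurable
    then have "(\<integral>\<^sup>+y. G y t \<partial>lborel) = ennreal \<bar>t\<bar> * (\<integral>\<^sup>+u. G (0 + t * u) t \<partial>lborel)"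
      by (rule nn_integral_real_affine) (use True in simp)
    then show ?thesis
      using True by (simp add: nn_integral_cmult)
  qed simp
  have scale_R: "(\<integral>\<^sup>+t. ennreal (indicator {0<..} t * t) * G (t * u) t \<partial>lborel) =
     (\<integral>\<^sup>+R. ennreal (indicator {0<..} R * (R / (1 + u\<^sup>2))) *
       G (R * u / sqrt (1 + u\<^sup>2)) (R / sqrt (1 + u\<^sup>2)) \<partial>lborel)" for u :: real
  proof -
    define c where "c = 1 / sqrt (1 + u\<^sup>2)"
    have c: "c > 0" "c * c = 1 / (1 + u\<^sup>2)"
      using pos[of u] by (auto simp: c_def)
    have "(\<lambda>t. ennreal (indicator {0<..} t * t) * G (t * u) t) \<in> borel_measurable borel"
      by measurable
    then have "(\<integral>\<^sup>+t. ennreal (indicator {0<..} t * t) * G (t * u) t \<partial>lborel) =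
      ennreal \<bar>c\<bar> * (\<integral>\<^sup>+R. ennreal (indicator {0<..} (0 + c * R) * (0 + c * R)) *
         G ((0 + c * R) * u) (0 + c * R) \<partial>lborel)"
      by (rule nn_integral_real_affine) (use c in simp)
    also have "\<dots> = (\<integral>\<^sup>+R. ennreal c * (ennreal (indicator {0<..} (c * R) * (c * R)) *
         G (c * R * u) (c * R)) \<partial>lborel)"
      using c by (subst nn_integral_cmult) auto
    also have "\<dots> = (\<integral>\<^sup>+R. ennreal (indicator {0<..} R * (R / (1 + u\<^sup>2))) *
         G (c * R * u) (c * R) \<partial>lborel)"
    proof (rule nn_integral_cong)
      fix R :: real
      have "ennreal c * ennreal (indicator {0<..} (c * R) * (c * R)) =
          ennreal (indicator {0<..} R * (R / (1 + u\<^sup>2)))"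
      proof -
        have "c * (c * R) = R / (1 + u\<^sup>2)"
          using c by (metis mult.assoc mult_1 times_divide_eq_left)
        then show ?thesis
          using c by (auto simp: indicator_def zero_less_mult_iff simp flip: ennreal_mult')
      qed
      then show "ennreal c * (ennreal (indicator {0<..} (c * R) * (c * R)) * G (c * R * u) (c * R)) =
          ennreal (indicator {0<..} R * (R / (1 + u\<^sup>2))) * G (c * R * u) (c * R)"
        by (simp add: mult.assoc[symmetric])
    qed
    finally show ?thesis
      by (simp add: c_def)
  qed
  have "(\<integral>\<^sup>+t. indicator {0<..} t * (\<integral>\<^sup>+y. G y t \<partial>lborel) \<partial>lborel) =
    (\<integral>\<^sup>+t. \<integral>\<^sup>+u. ennreal (indicator {0<..} t * t) * G (t * u) t \<partial>lborel \<partial>lborel)"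
    by (simp add: scale_y)
  also have "\<dots> = (\<integral>\<^sup>+u. \<integral>\<^sup>+t. ennreal (indicator {0<..} t * t) * G (t * u) t \<partial>lborel \<partial>lborel)"
    by (rule lborel_pair.Fubini') measurable
  finally show ?thesis
    by (simp add: scale_R)
qed

lemma distr_gnomonic:
  "distr (density (lborel \<Otimes>\<^sub>M lborel) (\<lambda>(u, R). ennreal (indicator {0<..} R * (R / (1 + u\<^sup>2))))) (borel \<Otimes>\<^sub>M borel)
     (\<lambda>(u :: real, R :: real). (R * u / sqrt (1 + u\<^sup>2), R / sqrt (1 + u\<^sup>2))) =
   density (lborel \<Otimes>\<^sub>M lborel) (\<lambda>(y, t). indicator {0<..} t)"
  (is "distr ?M _ ?T = ?N")
proof (rule measure_eqI)
  fix A
  assume "A \<in> sets (distr ?M (borel \<Otimes>\<^sub>M borel) ?T)"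
  then have A[measurable]: "A \<in> sets (borel \<Otimes>\<^sub>M borel)"
    by simp
  let ?G = "\<lambda>y t. indicator A (y, t) :: ennreal"
  have T: "?T \<in> ?M \<rightarrow>\<^sub>M borel \<Otimes>\<^sub>M borel"
    by measurable
  have "emeasure (distr ?M (borel \<Otimes>\<^sub>M borel) ?T) A =
      (\<integral>\<^sup>+z. indicator A z \<partial>distr ?M (borel \<Otimes>\<^sub>M borel) ?T)"
    by simp
  also have "\<dots> = (\<integral>\<^sup>+z. indicator A (?T z) \<partial>?M)"
    by (rule nn_integral_distr[OF T]) measurable
  also have "\<dots> = (\<integral>\<^sup>+z. (case z of (u, R) \<Rightarrow> ennreal (indicator {0<..} R * (R / (1 + u\<^sup>2)))) *
      indicator A (?T z) \<partial>(lborel \<Otimes>\<^sub>M lborel))"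
    by (subst nn_integral_density) (auto simp: case_prod_unfold)
  also have "\<dots> = (\<integral>\<^sup>+u. \<integral>\<^sup>+R. ennreal (indicator {0<..} R * (R / (1 + u\<^sup>2))) *
       ?G (R * u / sqrt (1 + u\<^sup>2)) (R / sqrt (1 + u\<^sup>2)) \<partial>lborel \<partial>lborel)"
    by (subst lborel.nn_integral_fst[symmetric]) (simp_all add: case_prod_unfold)
  also have "\<dots> = (\<integral>\<^sup>+t. indicator {0<..} t * (\<integral>\<^sup>+y. ?G y t \<partial>lborel) \<partial>lborel)"
    by (rule nn_integral_gnomonic[symmetric]) measurable
  also have "\<dots> = (\<integral>\<^sup>+t. \<integral>\<^sup>+y. indicator {0<..} t * ?G y t \<partial>lborel \<partial>lborel)"
    by (intro nn_integral_cong nn_integral_cmult[symmetric]) measurable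
  also have "\<dots> = (\<integral>\<^sup>+z. (case z of (y, t) \<Rightarrow> indicator {0<..} t) * indicator A z \<partial>(lborel \<Otimes>\<^sub>M lborel))"
    by (subst lborel_pair.nn_integral_snd[symmetric]) (simp_all add: case_prod_unfold)
  also have "\<dots> = emeasure ?N A"
    by (subst emeasure_density) (auto simp: case_prod_unfold)
  finally show "emeasure (distr ?M (borel \<Otimes>\<^sub>M borel) ?T) A = emeasure ?N A" .
qed (simp cong: sets_pair_measure_cong)

lemma integrable_inverse_1_plus_square: "integrable lborel (\<lambda>u::real. 1 / (1 + u\<^sup>2))"
proof -
  have "set_integrable lborel (einterval (-\<infinity>) \<infinity>) (\<lambda>u::real. 1 / (1 + u\<^sup>2))"
  proof (rule interval_integral_FTC_nonneg)
    show "((arctan \<circ> real_of_ereal) \<longlongrightarrow> - (pi / 2)) (at_right (- \<infinity>))"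
      using tendsto_arctan_at_bot by (simp add: ereal_tendsto_simps)
    show "((arctan \<circ> real_of_ereal) \<longlongrightarrow> pi / 2) (at_left \<infinity>)"
      using tendsto_arctan_at_top by (simp add: ereal_tendsto_simps)
    show "DERIV arctan x :> 1 / (1 + x\<^sup>2)" for x
      using DERIV_arctan[of x] by (simp add: field_simps)
    show "isCont (\<lambda>u. 1 / (1 + u\<^sup>2)) x" for x :: real
      by (intro continuous_intros) (simp add: power2_eq_square add_nonneg_eq_0_iff)
  qed auto
  then show ?thesis
    by (simp add: set_integrable_def)
qed

lemma
  fixes f :: "real \<Rightarrow> real \<Rightarrow> real" and \<Psi> :: "real \<Rightarrow> real"
  assumes f[measurable]: "case_prod f \<in> borel_measurable (borel \<Otimes>\<^sub>M borel)"
    and \<Psi>[measurable]: "\<Psi> \<in> borel_measurable borel"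
    and hom: "\<And>c y t. c > 0 \<Longrightarrow> t > 0 \<Longrightarrow> f (c * y) (c * t) = c ^ N * f y t"
    and bound: "\<And>u. \<bar>f u 1\<bar> \<le> K * sqrt (1 + u\<^sup>2) ^ N"
    and int: "set_integrable lborel {0<..} (\<lambda>R. \<Psi> R * R ^ Suc N)"
  shows integrable_half_plane_radial:
      "integrable (lborel \<Otimes>\<^sub>M lborel) (\<lambda>(y, t). indicator {0<..} t * (\<Psi> (sqrt (y\<^sup>2 + t\<^sup>2)) * f y t))"
      (is ?thesis1)
    and integral_half_plane_radial:
      "(\<integral>(y, t). indicator {0<..} t * (\<Psi> (sqrt (y\<^sup>2 + t\<^sup>2)) * f y t) \<partial>(lborel \<Otimes>\<^sub>M lborel)) =
        (\<integral>u. f u 1 / sqrt (1 + u\<^sup>2) ^ (N + 2) \<partial>lborel) * (LINT R:{0<..}|lborel. \<Psi> R * R ^ Suc N)"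
      (is ?thesis2)
proof -
  let ?LL = "lborel \<Otimes>\<^sub>M lborel :: (real \<times> real) measure"
  let ?w = "\<lambda>z :: real \<times> real. indicator {0<..} (snd z) * (snd z / (1 + (fst z)\<^sup>2)) :: real"
  let ?T = "\<lambda>(u :: real, R :: real). (R * u / sqrt (1 + u\<^sup>2), R / sqrt (1 + u\<^sup>2))"
  let ?g = "\<lambda>(y, t). \<Psi> (sqrt (y\<^sup>2 + t\<^sup>2)) * f y t"
  let ?i = "\<lambda>z :: real \<times> real. indicator {0<..} (snd z) :: real"
  let ?p = "\<lambda>u. f u 1 / sqrt (1 + u\<^sup>2) ^ (N + 2)"
  let ?q = "\<lambda>R. indicator {0<..} R * (\<Psi> R * R ^ Suc N)"
  have pos: "0 < 1 + u\<^sup>2" for u :: real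
    by (simp add: add_pos_nonneg)
  have g[measurable]: "?g \<in> borel_measurable (borel \<Otimes>\<^sub>M borel)"
    by measurable
  have T: "?T \<in> density ?LL ?w \<rightarrow>\<^sub>M borel \<Otimes>\<^sub>M borel"
    by measurable
  have wn: "AE z in ?LL. 0 \<le> ?w z"
    by (auto simp: indicator_def)
  have eq: "distr (density ?LL ?w) (borel \<Otimes>\<^sub>M borel) ?T = density ?LL ?i"
    using distr_gnomonic by (simp add: case_prod_unfold ennreal_indicator)
  have gT: "?w z * ?g (?T z) = (case z of (u, R) \<Rightarrow> ?p u * ?q R)" for z
  proof (cases z)
    case (Pair u R)
    show ?thesis
    proof (cases "R > 0")
      case True
      define s where "s = sqrt (1 + u\<^sup>2)"
      have s: "s > 0" "s * s = 1 + u\<^sup>2"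
        using pos[of u] by (auto simp: s_def)
      have "(R * u / s)\<^sup>2 + (R / s)\<^sup>2 = R\<^sup>2 * (1 + u\<^sup>2) / (s * s)"
        by (simp add: power2_eq_square distrib_left add_divide_distrib mult_ac)
      then have r: "sqrt ((R * u / s)\<^sup>2 + (R / s)\<^sup>2) = R"
        using True s pos[of u] by simp
      have "f (R * u / s) (R / s) = (R / s) ^ N * f u 1"
        using hom[of "R / s" 1 u] True s by (simp add: mult.commute)
      then have "?w z * ?g (?T z) = R / (s * s) * (\<Psi> R * ((R / s) ^ N * f u 1))"
        using True by (simp add: Pair s_def[symmetric] r s(2))
      also have "\<dots> = f u 1 / s ^ (N + 2) * (\<Psi> R * R ^ Suc N)"
        using s(1) by (simp add: field_simps)
      finally show ?thesis
        using True by (simp add: Pair s_def)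
    qed (simp add: Pair)
  qed
  have p: "integrable lborel ?p"
  proof (rule Bochner_Integration.integrable_bound)
    show "integrable lborel (\<lambda>u::real. K * (1 / (1 + u\<^sup>2)))"
      by (intro integrable_mult_right integrable_inverse_1_plus_square)
    show "AE u in lborel. norm (?p u) \<le> norm (K * (1 / (1 + u\<^sup>2)))"
    proof (rule AE_I2)
      fix u :: real
      define s where "s = sqrt (1 + u\<^sup>2)"
      have s: "s > 0" "s * s = 1 + u\<^sup>2"
        using pos[of u] by (auto simp: s_def)
      have "\<bar>f u 1\<bar> / s ^ (N + 2) \<le> K * s ^ N / s ^ (N + 2)"
        using s(1) by (intro divide_right_mono bound[of u, folded s_def]) simp
      also have "\<dots> = K * (1 / (1 + u\<^sup>2))"
        using s by simp
      also have "\<dots> \<le> norm (K * (1 / (1 + u\<^sup>2)))"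
        by (simp only: real_norm_def abs_ge_self)
      finally have "\<bar>f u 1\<bar> / s ^ (N + 2) \<le> norm (K * (1 / (1 + u\<^sup>2)))" .
      then show "norm (?p u) \<le> norm (K * (1 / (1 + u\<^sup>2)))"
        using s(1) by (simp add: s_def[symmetric])
    qed
  qed measurable
  have q: "integrable lborel ?q"
    using int by (simp add: set_integrable_def)
  have pq: "integrable ?LL (\<lambda>(u, R). ?p u * ?q R)"
  proof (rule lborel_pair.Fubini_integrable)
    show "AE u in lborel. integrable lborel (\<lambda>R. case (u, R) of (u, R) \<Rightarrow> ?p u * ?q R)"
      using q by auto
    show "integrable lborel (\<lambda>u. \<integral>R. norm (case (u, R) of (u, R) \<Rightarrow> ?p u * ?q R) \<partial>lborel)"
      unfolding prod.case norm_mult integral_mult_right_zero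
      by (intro integrable_mult_left integrable_norm p)
  qed measurable
  have "integrable (density ?LL ?i) ?g"
    unfolding eq[symmetric]
    by (subst integrable_distr_eq[OF T g], subst integrable_real_density[OF _ wn])
       (use pq gT in \<open>simp_all add: measurable_lborel1\<close>)
  then show ?thesis1
    by (subst (asm) integrable_real_density) (auto simp: case_prod_unfold)
  have "integral\<^sup>L ?LL (\<lambda>z. ?i z * ?g z) = integral\<^sup>L (density ?LL ?i) ?g"
    by (subst integral_real_density) (auto simp: case_prod_unfold)
  also have "\<dots> = integral\<^sup>L ?LL (\<lambda>z. ?w z * ?g (?T z))"
    unfolding eq[symmetric]
    by (subst integral_distr[OF T g], subst integral_real_density[OF _ wn]) simp_all
  also have "\<dots> = integral\<^sup>L ?LL (\<lambda>(u, R). ?p u * ?q R)"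
    by (simp only: gT)
  also have "\<dots> = (\<integral>u. \<integral>R. ?p u * ?q R \<partial>lborel \<partial>lborel)"
    using lborel_pair.integral_fst'[OF pq] by simp
  also have "\<dots> = integral\<^sup>L lborel ?p * integral\<^sup>L lborel ?q"
    by (simp only: integral_mult_right_zero integral_mult_left_zero)
  finally show ?thesis2
    by (simp add: case_prod_unfold set_lebesgue_integral_def)
qed

interpretation lborel_PiM: product_sigma_finite "\<lambda>_::nat. lborel :: real measure" ..

lemma L2_set_fun_upd_insert:
  assumes "finite I" "i \<notin> I"
  shows "L2_set (x(i := y)) (insert i I) = sqrt (y\<^sup>2 + (L2_set x I)\<^sup>2)"
proof -
  have "L2_set (x(i := y)) I = L2_set x I"
    using assms by (intro L2_set_cong) auto
  then show ?thesis
    using assms by simp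
qed

lemma measurable_L2_set_PiM:
  assumes "J \<subseteq> I"
  shows "(\<lambda>x. L2_set x J) \<in> borel_measurable (Pi\<^sub>M I (\<lambda>_. lborel :: real measure))"
proof (cases "finite J")
  case True
  have "(\<lambda>x. \<Sum>i\<in>J. (x i)\<^sup>2) \<in> borel_measurable (Pi\<^sub>M I (\<lambda>_. lborel :: real measure))"
  proof (intro borel_measurable_sum borel_measurable_power)
    fix i
    assume "i \<in> J"
    then have "i \<in> I"
      using assms by auto
    then show "(\<lambda>x. x i) \<in> borel_measurable (Pi\<^sub>M I (\<lambda>_. lborel :: real measure))"
      by measurable
  qed
  then show ?thesis
    unfolding L2_set_def by (rule measurable_compose) simp
qed simp

text \<open>The step of the induction is the gnomonic substitution for the function
  \<open>G y t = \<psi> (sqrt (y\<^sup>2 + t\<^sup>2)) * t ^ (card I - 1)\<close>.\<close>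

lemma nn_integral_radial:
  assumes "finite I" "I \<noteq> {}"
  shows "\<exists>\<kappa>. \<kappa> < \<infinity> \<and> (\<forall>\<psi> \<in> borel_measurable borel.
    (\<integral>\<^sup>+x. \<psi> (L2_set x I) \<partial>Pi\<^sub>M I (\<lambda>_::nat. lborel)) =
      \<kappa> * (\<integral>\<^sup>+t. indicator {0<..} t * (\<psi> t * ennreal (t ^ (card I - 1))) \<partial>lborel))"
  using assms
proof (induction I rule: finite_ne_induct)
  case (singleton i)
  show ?case
  proof (intro exI conjI ballI)
    show "(2 :: ennreal) < \<infinity>"
      by simp
    fix \<psi> :: "real \<Rightarrow> ennreal"
    assume [measurable]: "\<psi> \<in> borel_measurable borel"
    let ?J = "\<integral>\<^sup>+t. indicator {0<..} t * \<psi> t \<partial>lborel"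
    have "(\<integral>\<^sup>+x. \<psi> (L2_set x {i}) \<partial>Pi\<^sub>M {i} (\<lambda>_::nat. lborel)) = (\<integral>\<^sup>+t. \<psi> \<bar>t\<bar> \<partial>lborel)"
      using lborel_PiM.product_nn_integral_singleton[of "\<lambda>t. \<psi> \<bar>t\<bar>" i] by simp
    also have "\<dots> = (\<integral>\<^sup>+t. indicator {0<..} t * \<psi> t + indicator {0<..} (-t) * \<psi> (-t) \<partial>lborel)"
    proof (rule nn_integral_cong_AE)
      show "AE t in lborel. \<psi> \<bar>t\<bar> = indicator {0<..} t * \<psi> t + indicator {0<..} (-t) * \<psi> (-t)"
        using AE_lborel_singleton[of 0] by eventually_elim (auto simp: indicator_def)
    qed
    also have "\<dots> = ?J + (\<integral>\<^sup>+t. indicator {0<..} (-t) * \<psi> (-t) \<partial>lborel)"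
      by (rule nn_integral_add) measurable
    also have "(\<integral>\<^sup>+t. indicator {0<..} (-t) * \<psi> (-t) \<partial>lborel) = ?J"
    proof -
      have "(\<lambda>t. indicator {0<..} t * \<psi> t) \<in> borel_measurable borel"
        by measurable
      from nn_integral_real_affine[OF this, of "-1" 0] show ?thesis
        by simp
    qed
    finally show "(\<integral>\<^sup>+x. \<psi> (L2_set x {i}) \<partial>Pi\<^sub>M {i} (\<lambda>_::nat. lborel)) =
      2 * (\<integral>\<^sup>+t. indicator {0<..} t * (\<psi> t * ennreal (t ^ (card {i} - 1))) \<partial>lborel)"
      by (simp add: mult_2)
  qed
next
  case (insert i I)
  then obtain \<kappa> where \<kappa>: "\<kappa> < \<infinity>"
    and IH: "\<And>\<psi>. \<psi> \<in> borel_measurable borel \<Longrightarrow> (\<integral>\<^sup>+x. \<psi> (L2_set x I) \<partial>Pi\<^sub>M I (\<lambda>_::nat. lborel)) =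
      \<kappa> * (\<integral>\<^sup>+t. indicator {0<..} t * (\<psi> t * ennreal (t ^ (card I - 1))) \<partial>lborel)"
    by blast
  define D where "D = card I - 1"
  have card: "card I = Suc D" "card (insert i I) - 1 = Suc D"
    using insert by (auto simp: D_def card_gt_0_iff)
  define c where "c = (\<integral>\<^sup>+u. ennreal (1 / ((1 + u\<^sup>2) * sqrt (1 + u\<^sup>2) ^ D)) \<partial>lborel)"
  have pos: "0 < 1 + u\<^sup>2" for u :: real
    by (simp add: add_pos_nonneg)
  have "c \<le> (\<integral>\<^sup>+u. ennreal (1 / (1 + u\<^sup>2)) \<partial>lborel)"
    unfolding c_def
  proof (intro nn_integral_mono ennreal_leI divide_left_mono)
    fix u :: real
    show "1 + u\<^sup>2 \<le> (1 + u\<^sup>2) * sqrt (1 + u\<^sup>2) ^ D"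
      using mult_left_mono[of 1 "sqrt (1 + u\<^sup>2) ^ D" "1 + u\<^sup>2"] by (simp add: one_le_power)
    show "0 < (1 + u\<^sup>2) * sqrt (1 + u\<^sup>2) ^ D * (1 + u\<^sup>2)"
      using pos[of u] by simp
  qed simp
  also have "\<dots> < \<infinity>"
    using integrable_inverse_1_plus_square
    by (simp add: integrable_iff_bounded)
  finally have c: "c < \<infinity>" .
  show ?case
  proof (intro exI conjI ballI)
    show "\<kappa> * c < \<infinity>"
      using \<kappa> c by (simp add: ennreal_mult_less_top)
    fix \<psi> :: "real \<Rightarrow> ennreal"
    assume [measurable]: "\<psi> \<in> borel_measurable borel"
    let ?J = "\<integral>\<^sup>+t. indicator {0<..} t * (\<psi> t * ennreal (t ^ Suc D)) \<partial>lborel"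
    have L2: "(\<lambda>x. L2_set x (insert i I)) \<in> borel_measurable (Pi\<^sub>M (insert i I) (\<lambda>_::nat. lborel :: real measure))"
      by (rule measurable_L2_set_PiM) simp
    have "(\<lambda>x. \<psi> (L2_set x (insert i I))) \<in> borel_measurable (Pi\<^sub>M (insert i I) (\<lambda>_::nat. lborel))"
      using L2 by (rule measurable_compose) simp
    with insert.hyps have "(\<integral>\<^sup>+x. \<psi> (L2_set x (insert i I)) \<partial>Pi\<^sub>M (insert i I) (\<lambda>_::nat. lborel)) =
      (\<integral>\<^sup>+x. \<integral>\<^sup>+y. \<psi> (L2_set (x(i := y)) (insert i I)) \<partial>lborel \<partial>Pi\<^sub>M I (\<lambda>_::nat. lborel))"
      by (intro lborel_PiM.product_nn_integral_insert) auto
    also have "\<dots> = (\<integral>\<^sup>+x. (\<lambda>t. \<integral>\<^sup>+y. \<psi> (sqrt (y\<^sup>2 + t\<^sup>2)) \<partial>lborel) (L2_set x I) \<partial>Pi\<^sub>M I (\<lambda>_::nat. lborel))"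
      using insert by (simp add: L2_set_fun_upd_insert del: L2_set_insert)
    also have "\<dots> = \<kappa> * (\<integral>\<^sup>+t. indicator {0<..} t *
        ((\<integral>\<^sup>+y. \<psi> (sqrt (y\<^sup>2 + t\<^sup>2)) \<partial>lborel) * ennreal (t ^ D)) \<partial>lborel)"
      unfolding D_def by (rule IH) measurable
    also have "\<dots> = \<kappa> * (\<integral>\<^sup>+t. indicator {0<..} t *
        (\<integral>\<^sup>+y. \<psi> (sqrt (y\<^sup>2 + t\<^sup>2)) * ennreal (t ^ D) \<partial>lborel) \<partial>lborel)"
      by (subst nn_integral_multc) simp_all
    also have "\<dots> = \<kappa> * (\<integral>\<^sup>+u. \<integral>\<^sup>+R. ennreal (indicator {0<..} R * (R / (1 + u\<^sup>2))) *
       (\<psi> (sqrt ((R * u / sqrt (1 + u\<^sup>2))\<^sup>2 + (R / sqrt (1 + u\<^sup>2))\<^sup>2)) *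
         ennreal ((R / sqrt (1 + u\<^sup>2)) ^ D)) \<partial>lborel \<partial>lborel)"
      by (subst nn_integral_gnomonic) simp_all
    also have "\<dots> = \<kappa> * (\<integral>\<^sup>+u. \<integral>\<^sup>+R. ennreal (1 / ((1 + u\<^sup>2) * sqrt (1 + u\<^sup>2) ^ D)) *
        (indicator {0<..} R * (\<psi> R * ennreal (R ^ Suc D))) \<partial>lborel \<partial>lborel)"
    proof (intro arg_cong[where f="(*) \<kappa>"] nn_integral_cong)
      fix u R :: real
      define s where "s = sqrt (1 + u\<^sup>2)"
      have s: "s > 0" "s * s = 1 + u\<^sup>2"
        using pos[of u] by (auto simp: s_def)
      show "ennreal (indicator {0<..} R * (R / (1 + u\<^sup>2))) *
          (\<psi> (sqrt ((R * u / sqrt (1 + u\<^sup>2))\<^sup>2 + (R / sqrt (1 + u\<^sup>2))\<^sup>2)) *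
          ennreal ((R / sqrt (1 + u\<^sup>2)) ^ D)) =
        ennreal (1 / ((1 + u\<^sup>2) * sqrt (1 + u\<^sup>2) ^ D)) *
          (indicator {0<..} R * (\<psi> R * ennreal (R ^ Suc D)))"
      proof (cases "R > 0")
        case True
        have "(R * u / s)\<^sup>2 + (R / s)\<^sup>2 = R\<^sup>2 * (1 + u\<^sup>2) / (s * s)"
          by (simp add: power2_eq_square distrib_left add_divide_distrib mult_ac)
        then have r: "sqrt ((R * u / s)\<^sup>2 + (R / s)\<^sup>2) = R"
          using True s pos[of u] by simp
        have "ennreal (R / (1 + u\<^sup>2)) * (\<psi> R * ennreal ((R / s) ^ D)) =
            \<psi> R * ennreal (R / (1 + u\<^sup>2) * (R / s) ^ D)"
          using True s by (subst ennreal_mult) (auto simp: mult_ac)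
        also have "R / (1 + u\<^sup>2) * (R / s) ^ D = 1 / ((1 + u\<^sup>2) * s ^ D) * R ^ Suc D"
          by (simp add: power_divide)
        also have "\<psi> R * ennreal \<dots> = ennreal (1 / ((1 + u\<^sup>2) * s ^ D)) * (\<psi> R * ennreal (R ^ Suc D))"
          using True s pos[of u] by (subst ennreal_mult) (auto simp: mult_ac)
        finally show ?thesis
          using True by (simp add: s_def[symmetric] r)
      qed simp
    qed
    also have "\<dots> = \<kappa> * (\<integral>\<^sup>+u. ennreal (1 / ((1 + u\<^sup>2) * sqrt (1 + u\<^sup>2) ^ D)) * ?J \<partial>lborel)"
      by (subst nn_integral_cmult) simp_all
    also have "\<dots> = \<kappa> * c * ?J"
      by (subst nn_integral_multc) (simp_all add: c_def mult.assoc)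
    finally show "(\<integral>\<^sup>+x. \<psi> (L2_set x (insert i I)) \<partial>Pi\<^sub>M (insert i I) (\<lambda>_::nat. lborel)) =
      \<kappa> * c * (\<integral>\<^sup>+t. indicator {0<..} t * (\<psi> t * ennreal (t ^ (card (insert i I) - 1))) \<partial>lborel)"
      by (simp only: card)
  qed
qed

lemma integrable_radial:
  fixes f :: "(nat \<Rightarrow> real) \<Rightarrow> real" and \<Psi> :: "real \<Rightarrow> real"
  assumes I: "finite I" "I \<noteq> {}"
    and f[measurable]: "f \<in> borel_measurable (Pi\<^sub>M I (\<lambda>_. lborel))"
    and \<Psi>[measurable]: "\<Psi> \<in> borel_measurable borel"
    and bound: "\<And>x. \<bar>f x\<bar> \<le> K * L2_set x I ^ N"
    and int: "set_integrable lborel {0<..} (\<lambda>t. \<Psi> t * t ^ (N + card I - 1))"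
  shows "integrable (Pi\<^sub>M I (\<lambda>_::nat. lborel)) (\<lambda>x. \<Psi> (L2_set x I) * f x)"
proof -
  let ?M = "Pi\<^sub>M I (\<lambda>_::nat. lborel :: real measure)"
  obtain \<kappa> where \<kappa>: "\<kappa> < \<infinity>" and
    eq: "\<And>\<psi>. \<psi> \<in> borel_measurable borel \<Longrightarrow> (\<integral>\<^sup>+x. \<psi> (L2_set x I) \<partial>?M) =
      \<kappa> * (\<integral>\<^sup>+t. indicator {0<..} t * (\<psi> t * ennreal (t ^ (card I - 1))) \<partial>lborel)"
    using nn_integral_radial[OF I] by blast
  have L2[measurable]: "(\<lambda>x. L2_set x I) \<in> borel_measurable ?M"
    by (rule measurable_L2_set_PiM) simp
  have card: "N + card I - 1 = N + (card I - 1)"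
    using I by (simp add: Suc_leI card_gt_0_iff)
  have "(\<integral>\<^sup>+x. norm (\<Psi> (L2_set x I) * L2_set x I ^ N) \<partial>?M) =
      (\<integral>\<^sup>+x. (\<lambda>t. ennreal (\<bar>\<Psi> t\<bar> * \<bar>t\<bar> ^ N)) (L2_set x I) \<partial>?M)"
    by (simp add: abs_mult power_abs)
  also have "\<dots> = \<kappa> * (\<integral>\<^sup>+t. indicator {0<..} t * (ennreal (\<bar>\<Psi> t\<bar> * \<bar>t\<bar> ^ N) * ennreal (t ^ (card I - 1))) \<partial>lborel)"
    by (rule eq) measurable
  also have "(\<integral>\<^sup>+t. indicator {0<..} t * (ennreal (\<bar>\<Psi> t\<bar> * \<bar>t\<bar> ^ N) * ennreal (t ^ (card I - 1))) \<partial>lborel) =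
      (\<integral>\<^sup>+t. norm (indicator {0<..} t *\<^sub>R (\<Psi> t * t ^ (N + card I - 1))) \<partial>lborel)"
    unfolding card
    by (intro nn_integral_cong) (auto simp: indicator_def abs_mult power_add mult.assoc simp flip: ennreal_mult)
  also have "\<kappa> * \<dots> < \<infinity>"
    using int \<kappa> unfolding set_integrable_def integrable_iff_bounded
    by (simp add: ennreal_mult_less_top)
  finally have "integrable ?M (\<lambda>x. \<Psi> (L2_set x I) * L2_set x I ^ N)"
    by (intro integrableI_bounded) measurable
  then have "integrable ?M (\<lambda>x. K * (\<Psi> (L2_set x I) * L2_set x I ^ N))"
    by (rule integrable_mult_right)
  then show ?thesis
  proof (rule Bochner_Integration.integrable_bound)
    show "AE x in ?M. norm (\<Psi> (L2_set x I) * f x) \<le> norm (K * (\<Psi> (L2_set x I) * L2_set x I ^ N))"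
    proof (rule AE_I2)
      fix x
      have "\<bar>\<Psi> (L2_set x I)\<bar> * \<bar>f x\<bar> \<le> \<bar>\<Psi> (L2_set x I)\<bar> * \<bar>K * L2_set x I ^ N\<bar>"
        using bound[of x] by (intro mult_left_mono) auto
      then show "norm (\<Psi> (L2_set x I) * f x) \<le> norm (K * (\<Psi> (L2_set x I) * L2_set x I ^ N))"
        by (simp add: abs_mult mult_ac)
    qed
  qed measurable
qed

section \<open>Angular integrals in the plane\<close>

lemma
  fixes f :: "real \<Rightarrow> real \<Rightarrow> real" and \<Psi> :: "real \<Rightarrow> real"
  assumes "case_prod f \<in> borel_measurable (borel \<Otimes>\<^sub>M borel)"
    and "\<Psi> \<in> borel_measurable borel"
    and "\<And>c y t. c > 0 \<Longrightarrow> t > 0 \<Longrightarrow> f (c * y) (c * t) = c ^ N * f y t"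
    and "\<And>u. \<bar>f u 1\<bar> \<le> K * sqrt (1 + u\<^sup>2) ^ N"
    and "set_integrable lborel {0<..} (\<lambda>R. \<Psi> R * R ^ Suc N)"
  shows set_integrable_half_plane_radial:
      "set_integrable lborel {0<..} (\<lambda>t. \<integral>y. \<Psi> (sqrt (y\<^sup>2 + t\<^sup>2)) * f y t \<partial>lborel)"
    and set_integral_half_plane_radial:
      "(LINT t:{0<..}|lborel. \<integral>y. \<Psi> (sqrt (y\<^sup>2 + t\<^sup>2)) * f y t \<partial>lborel) =
        (\<integral>u. f u 1 / sqrt (1 + u\<^sup>2) ^ (N + 2) \<partial>lborel) * (LINT R:{0<..}|lborel. \<Psi> R * R ^ Suc N)"
proof -
  let ?f = "\<lambda>y t. indicator {0<..} t * (\<Psi> (sqrt (y\<^sup>2 + t\<^sup>2)) * f y t)"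
  note int = integrable_half_plane_radial[OF assms]
  show "set_integrable lborel {0<..} (\<lambda>t. \<integral>y. \<Psi> (sqrt (y\<^sup>2 + t\<^sup>2)) * f y t \<partial>lborel)"
    using lborel_pair.integrable_snd[OF int] by (simp add: set_integrable_def)
  have "(LINT t:{0<..}|lborel. \<integral>y. \<Psi> (sqrt (y\<^sup>2 + t\<^sup>2)) * f y t \<partial>lborel) =
      (\<integral>t. \<integral>y. ?f y t \<partial>lborel \<partial>lborel)"
    by (simp add: set_lebesgue_integral_def)
  also have "\<dots> = (\<integral>(y, t). ?f y t \<partial>(lborel \<Otimes>\<^sub>M lborel))"
    by (rule lborel_pair.integral_snd[OF int])
  also have "\<dots> = (\<integral>u. f u 1 / sqrt (1 + u\<^sup>2) ^ (N + 2) \<partial>lborel) * (LINT R:{0<..}|lborel. \<Psi> R * R ^ Suc N)"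
    by (rule integral_half_plane_radial[OF assms])
  finally show "(LINT t:{0<..}|lborel. \<integral>y. \<Psi> (sqrt (y\<^sup>2 + t\<^sup>2)) * f y t \<partial>lborel) =
    (\<integral>u. f u 1 / sqrt (1 + u\<^sup>2) ^ (N + 2) \<partial>lborel) * (LINT R:{0<..}|lborel. \<Psi> R * R ^ Suc N)" .
qed

lemma integral_lborel_radial_parity:
  fixes \<phi> :: "real \<Rightarrow> real"
  assumes \<phi>[measurable]: "\<phi> \<in> borel_measurable borel"
    and par: "\<And>t. \<phi> (- t) = (-1) ^ N * \<phi> t"
    and int: "set_integrable lborel {0<..} \<phi>"
  shows "integral\<^sup>L lborel \<phi> = (1 + (-1) ^ N) * (LINT t:{0<..}|lborel. \<phi> t)"
proof -
  let ?p = "\<lambda>t. indicator {0<..} t * \<phi> t"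
  have p: "integrable lborel ?p"
    using int by (simp add: set_integrable_def)
  have m: "integrable lborel (\<lambda>t. ?p (- t))"
    using lborel_integrable_real_affine[OF p, of "-1" 0] by simp
  have AE: "AE t in lborel. \<phi> t = ?p t + (-1) ^ N * ?p (- t)"
    using AE_lborel_singleton[of 0]
  proof eventually_elim
    case (elim t)
    have "((-1) ^ N * (-1) ^ N :: real) = 1"
      by (simp flip: power_mult_distrib)
    then show ?case
      using elim par[of t] by (auto simp: indicator_def mult.assoc[symmetric])
  qed
  have "integral\<^sup>L lborel \<phi> = (\<integral>t. ?p t + (-1) ^ N * ?p (- t) \<partial>lborel)"
    by (rule integral_cong_AE[OF _ _ AE]) measurable
  also have "\<dots> = integral\<^sup>L lborel ?p + (-1) ^ N * integral\<^sup>L lborel (\<lambda>t. ?p (- t))"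
    using p m by simp
  also have "integral\<^sup>L lborel (\<lambda>t. ?p (- t)) = integral\<^sup>L lborel ?p"
    using lborel_integral_real_affine[of "-1" ?p 0] by simp
  finally show ?thesis
    by (simp add: set_lebesgue_integral_def algebra_simps)
qed

text \<open>The point \<open>\<zeta> = exp (i \<theta>)\<close> with \<open>u = cot \<theta>\<close>, \<open>0 < \<theta> < \<pi>\<close>; the measure \<open>du / (1 + u\<^sup>2)\<close> is \<open>d\<theta>\<close>.\<close>

definition cis_cot :: "real \<Rightarrow> complex" where
  "cis_cot u = Complex u 1 / complex_of_real (sqrt (1 + u\<^sup>2))"

lemma
  shows norm_cis_cot: "norm (cis_cot u) = 1"
    and cos_cis_cot: "2 * complex_of_real (u / sqrt (1 + u\<^sup>2)) = cis_cot u + inverse (cis_cot u)"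
    and sin_cis_cot: "2 * \<i> * complex_of_real (1 / sqrt (1 + u\<^sup>2)) = cis_cot u - inverse (cis_cot u)"
    and cis_cot_square: "(cis_cot u)\<^sup>2 = (complex_of_real u + \<i>) / (complex_of_real u - \<i>)"
proof -
  have pos: "0 < 1 + u\<^sup>2"
    by (simp add: add_pos_nonneg)
  have "norm (Complex u 1) = sqrt (1 + u\<^sup>2)"
    by (simp add: cmod_def add.commute)
  then show n: "norm (cis_cot u) = 1"
    using pos by (simp add: cis_cot_def norm_divide)
  have inv: "inverse (cis_cot u) = cnj (cis_cot u)"
    using complex_norm_square[of "cis_cot u"] n
    by (intro inverse_unique) simp
  show "2 * complex_of_real (u / sqrt (1 + u\<^sup>2)) = cis_cot u + inverse (cis_cot u)"
    "2 * \<i> * complex_of_real (1 / sqrt (1 + u\<^sup>2)) = cis_cot u - inverse (cis_cot u)"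
    unfolding inv by (simp_all add: cis_cot_def complex_eq_iff)
  have ne: "complex_of_real u - \<i> \<noteq> 0"
    by (simp add: complex_eq_iff)
  have z: "Complex u 1 = complex_of_real u + \<i>"
    by (simp add: complex_eq_iff)
  have "(complex_of_real (sqrt (1 + u\<^sup>2)))\<^sup>2 = complex_of_real (1 + u\<^sup>2)"
    using pos by (simp flip: of_real_power)
  also have "\<dots> = (complex_of_real u + \<i>) * (complex_of_real u - \<i>)"
    by (simp add: algebra_simps power2_eq_square)
  finally have "(cis_cot u)\<^sup>2 = (complex_of_real u + \<i>)\<^sup>2 / ((complex_of_real u + \<i>) * (complex_of_real u - \<i>))"
    by (simp add: cis_cot_def z power_divide)
  then show "(cis_cot u)\<^sup>2 = (complex_of_real u + \<i>) / (complex_of_real u - \<i>)"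
    using ne by (cases "complex_of_real u + \<i> = 0") (auto simp: power2_eq_square)
qed

lemma measurable_cis_cot [measurable]: "cis_cot \<in> borel_measurable borel"
  unfolding cis_cot_def Complex_eq by measurable

lemma integrable_cis_cot:
  "integrable lborel (\<lambda>u. cis_cot u ^ n *
     complex_of_real ((u / sqrt (1 + u\<^sup>2)) ^ a * (1 / sqrt (1 + u\<^sup>2)) ^ b / (1 + u\<^sup>2)))"
proof (rule Bochner_Integration.integrable_bound[OF integrable_inverse_1_plus_square])
  show "AE u in lborel. norm (cis_cot u ^ n *
     complex_of_real ((u / sqrt (1 + u\<^sup>2)) ^ a * (1 / sqrt (1 + u\<^sup>2)) ^ b / (1 + u\<^sup>2))) \<le> norm (1 / (1 + u\<^sup>2))"
  proof (rule AE_I2)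
    fix u :: real
    have pos: "0 < 1 + u\<^sup>2"
      by (simp add: add_pos_nonneg)
    have 1: "\<bar>u / sqrt (1 + u\<^sup>2)\<bar> \<le> 1" "\<bar>1 / sqrt (1 + u\<^sup>2)\<bar> \<le> 1"
      using pos by (auto simp: abs_divide intro!: real_le_rsqrt)
    have "\<bar>(u / sqrt (1 + u\<^sup>2)) ^ a * (1 / sqrt (1 + u\<^sup>2)) ^ b\<bar> \<le> 1 * 1"
      unfolding abs_mult power_abs by (intro mult_mono power_le_one 1) auto
    then have "\<bar>(u / sqrt (1 + u\<^sup>2)) ^ a * (1 / sqrt (1 + u\<^sup>2)) ^ b\<bar> / (1 + u\<^sup>2) \<le> 1 / (1 + u\<^sup>2)"
      using pos by (intro divide_right_mono) auto
    then show "norm (cis_cot u ^ n *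
        complex_of_real ((u / sqrt (1 + u\<^sup>2)) ^ a * (1 / sqrt (1 + u\<^sup>2)) ^ b / (1 + u\<^sup>2))) \<le> norm (1 / (1 + u\<^sup>2))"
      using pos unfolding norm_mult norm_power norm_cis_cot norm_of_real abs_divide by simp
  qed
qed measurable

lemma integral_cis_cot_power_even:
  assumes "j > 0"
  shows "(\<integral>u. cis_cot u ^ (2 * j) * complex_of_real (1 / (1 + u\<^sup>2)) \<partial>lborel) = 0"
proof -
  let ?E = "\<lambda>w :: complex. (w + \<i>) / (w - \<i>)"
  let ?F = "\<lambda>w. \<i> / (2 * of_nat j) * ?E w ^ j"
  have int: "set_integrable lborel (einterval (-\<infinity>) \<infinity>) (\<lambda>u. cis_cot u ^ (2 * j) * complex_of_real (1 / (1 + u\<^sup>2)))"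
    using integrable_cis_cot[of "2 * j" 0 0] by (simp add: set_integrable_def)
  have lim: "((\<lambda>u. ?F (complex_of_real u)) \<longlongrightarrow> \<i> / (2 * of_nat j) * 1 ^ j) F"
    if "filterlim (\<lambda>u. complex_of_real u) at_infinity F" for F
  proof (intro tendsto_intros)
    have inv: "((\<lambda>u. \<i> / complex_of_real u) \<longlongrightarrow> 0) F"
      using that by (intro tendsto_divide_0[OF tendsto_const])
    have "((\<lambda>u. (1 + \<i> / complex_of_real u) / (1 - \<i> / complex_of_real u)) \<longlongrightarrow> (1 + 0) / (1 - 0)) F"
      by (intro tendsto_intros inv) simp
    moreover have "\<forall>\<^sub>F u in F. (1 + \<i> / complex_of_real u) / (1 - \<i> / complex_of_real u) = ?E (complex_of_real u)"
    proof -
      have "\<forall>\<^sub>F u in F. complex_of_real u \<noteq> 0"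
        using that by (rule filterlim_at_infinity_imp_eventually_ne)
      then show ?thesis
      proof eventually_elim
        case (elim u)
        have "complex_of_real u - \<i> \<noteq> 0"
          by (simp add: complex_eq_iff)
        with elim show ?case
          by (simp add: field_simps)
      qed
    qed
    ultimately show "((\<lambda>u. ?E (complex_of_real u)) \<longlongrightarrow> 1) F"
      by (simp add: tendsto_cong)
  qed
  have "(LBINT u=-\<infinity>..\<infinity>. cis_cot u ^ (2 * j) * complex_of_real (1 / (1 + u\<^sup>2))) =
    \<i> / (2 * of_nat j) * 1 ^ j - \<i> / (2 * of_nat j) * 1 ^ j"
  proof (rule interval_integral_FTC_integrable[OF _ _ _ int])
    fix u :: real
    have ne: "complex_of_real u - \<i> \<noteq> 0"
      by (simp add: complex_eq_iff)
    have sq: "complex_of_real (1 + u\<^sup>2) = (complex_of_real u + \<i>) * (complex_of_real u - \<i>)"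
      by (simp add: algebra_simps power2_eq_square)
    have ne': "complex_of_real u + \<i> \<noteq> 0"
      by (simp add: complex_eq_iff)
    have "(?F has_field_derivative
      \<i> / (2 * of_nat j) * (of_nat j * ?E (of_real u) ^ (j - 1) * ((1 * (of_real u - \<i>) - (of_real u + \<i>) * 1) / ((of_real u - \<i>) * (of_real u - \<i>))))) (at (of_real u))"
      using ne by (auto intro!: derivative_eq_intros)
    also have "\<i> / (2 * of_nat j) * (of_nat j * ?E (of_real u) ^ (j - 1) * ((1 * (of_real u - \<i>) - (of_real u + \<i>) * 1) / ((of_real u - \<i>) * (of_real u - \<i>)))) =
       ?E (of_real u) ^ (j - 1) / ((complex_of_real u - \<i>) * (complex_of_real u - \<i>))"
      using assms ne by (simp add: field_simps)
    also have "\<dots> = ?E (of_real u) ^ (j - 1) * ?E (of_real u) / ((complex_of_real u + \<i>) * (complex_of_real u - \<i>))"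
      using ne ne' by simp
    also have "?E (of_real u) ^ (j - 1) * ?E (of_real u) = ?E (of_real u) ^ j"
      using assms by (rule power_minus_mult)
    also have "\<dots> / ((complex_of_real u + \<i>) * (complex_of_real u - \<i>)) =
        cis_cot u ^ (2 * j) * complex_of_real (1 / (1 + u\<^sup>2))"
      by (simp only: power_mult cis_cot_square sq[symmetric] of_real_divide of_real_1 times_divide_eq_right mult_1_right)
    finally show "((\<lambda>u. ?F (complex_of_real u)) has_vector_derivative
        cis_cot u ^ (2 * j) * complex_of_real (1 / (1 + u\<^sup>2))) (at u)"
      by (rule has_vector_derivative_real_field)
    have pos: "0 < 1 + u\<^sup>2"
      by (simp add: add_pos_nonneg)
    show "isCont (\<lambda>u. cis_cot u ^ (2 * j) * complex_of_real (1 / (1 + u\<^sup>2))) u"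
      unfolding cis_cot_def Complex_eq using pos
      by (intro continuous_intros) auto
  next
    show "(((\<lambda>u. ?F (complex_of_real u)) \<circ> real_of_ereal) \<longlongrightarrow> \<i> / (2 * of_nat j) * 1 ^ j) (at_left \<infinity>)"
      unfolding ereal_tendsto_simps by (rule lim) (rule filterlim_of_real_at_infinity)
    show "(((\<lambda>u. ?F (complex_of_real u)) \<circ> real_of_ereal) \<longlongrightarrow> \<i> / (2 * of_nat j) * 1 ^ j) (at_right (-\<infinity>))"
      unfolding ereal_tendsto_simps 
    proof (rule lim)
      show "filterlim (\<lambda>u. complex_of_real u) at_infinity at_bot"
        unfolding filterlim_at_infinity_conv_norm_at_top norm_of_real
        by (rule filterlim_at_top_mono[OF filterlim_uminus_at_top_at_bot]) (auto intro!: always_eventually)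
    qed
  qed simp
  then show ?thesis
    by (simp add: interval_integral_to_infinity_eq interval_lebesgue_integral_def set_lebesgue_integral_def)
qed

lemma integral_cis_cot_eq_0:
  assumes "a + b < n" "even (n + a + b)"
  shows "(\<integral>u. cis_cot u ^ n *
     complex_of_real ((u / sqrt (1 + u\<^sup>2)) ^ a * (1 / sqrt (1 + u\<^sup>2)) ^ b / (1 + u\<^sup>2)) \<partial>lborel) = 0"
  using assms
proof (induction "a + b" arbitrary: a b n)
  case 0
  then obtain j where "n = 2 * j"
    by auto
  with 0 show ?case
    using integral_cis_cot_power_even[of j] by simp
next
  case (Suc k)
  let ?I = "\<lambda>n a b u. cis_cot u ^ n *
     complex_of_real ((u / sqrt (1 + u\<^sup>2)) ^ a * (1 / sqrt (1 + u\<^sup>2)) ^ b / (1 + u\<^sup>2))"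
  note IH = Suc.hyps(1) and k = Suc.hyps(2) and prems = Suc.prems
  from Suc.prems obtain l where l: "n = Suc l"
    by (cases n) auto
  have ne: "cis_cot u \<noteq> 0" for u
    using norm_cis_cot[of u] by auto
  have shift: "cis_cot u ^ n * (cis_cot u + inverse (cis_cot u)) = cis_cot u ^ Suc n + cis_cot u ^ l"
    "cis_cot u ^ n * (cis_cot u - inverse (cis_cot u)) = cis_cot u ^ Suc n - cis_cot u ^ l" for u
    using ne[of u] by (simp_all add: l field_simps)
  show ?case
  proof (cases a)
    case (Suc a')
    have step: "?I n a b u = (?I (Suc n) a' b u + ?I l a' b u) / 2" for u
    proof -
      have "?I n a b u = cis_cot u ^ n * (2 * complex_of_real (u / sqrt (1 + u\<^sup>2))) *
          complex_of_real ((u / sqrt (1 + u\<^sup>2)) ^ a' * (1 / sqrt (1 + u\<^sup>2)) ^ b / (1 + u\<^sup>2)) / 2"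
        by (simp add: Suc)
      also have "\<dots> = (?I (Suc n) a' b u + ?I l a' b u) / 2"
        unfolding cos_cis_cot shift by (simp only: ring_distribs)
      finally show ?thesis .
    qed
    have zero: "(\<integral>u. ?I (Suc n) a' b u \<partial>lborel) = 0" "(\<integral>u. ?I l a' b u \<partial>lborel) = 0"
      using k prems Suc l by (intro IH; simp)+
    show ?thesis
      unfolding step integral_divide_zero Bochner_Integration.integral_add[OF integrable_cis_cot integrable_cis_cot] zero
      by simp
  next
    case 0
    then obtain b' where b: "b = Suc b'"
      using Suc.hyps by (cases b) auto
    have step: "?I n a b u = (?I (Suc n) a b' u - ?I l a b' u) / (2 * \<i>)" for u
    proof -
      have "?I n a b u = cis_cot u ^ n * (2 * \<i> * complex_of_real (1 / sqrt (1 + u\<^sup>2))) *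
          complex_of_real ((u / sqrt (1 + u\<^sup>2)) ^ a * (1 / sqrt (1 + u\<^sup>2)) ^ b' / (1 + u\<^sup>2)) / (2 * \<i>)"
      proof -
        have ii: "w * (r * x) = w * (2 * \<i> * r) * x / (2 * \<i>)" for w r x :: complex
          by (simp add: field_simps)
        have "?I n a b u = cis_cot u ^ n * (complex_of_real (1 / sqrt (1 + u\<^sup>2)) *
            complex_of_real ((u / sqrt (1 + u\<^sup>2)) ^ a * (1 / sqrt (1 + u\<^sup>2)) ^ b' / (1 + u\<^sup>2)))"
          by (simp add: b)
        also note ii
        finally show ?thesis .
      qed
      also have "\<dots> = (?I (Suc n) a b' u - ?I l a b' u) / (2 * \<i>)"
        unfolding sin_cis_cot shift by (simp only: ring_distribs)
      finally show ?thesis .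
    qed
    have zero: "(\<integral>u. ?I (Suc n) a b' u \<partial>lborel) = 0" "(\<integral>u. ?I l a b' u \<partial>lborel) = 0"
      using k prems b l 0 by (intro IH; simp)+
    show ?thesis
      unfolding step integral_divide_zero Bochner_Integration.integral_diff[OF integrable_cis_cot integrable_cis_cot] zero
      by simp
  qed
qed

section \<open>Gegenbauer moments\<close>

definition circ_part :: "nat \<Rightarrow> complex \<Rightarrow> real" where
  "circ_part \<epsilon> w = (if \<epsilon> = 0 then Re w else Im w)"

lemma bounded_linear_circ_part: "bounded_linear (circ_part \<epsilon>)"
  by (cases "\<epsilon> = 0") (simp_all add: circ_part_def[abs_def] bounded_linear_Re bounded_linear_Im)

lemma abs_circ_part_le: "\<bar>circ_part \<epsilon> w\<bar> \<le> norm w"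
  by (simp add: circ_part_def abs_Re_le_cmod abs_Im_le_cmod)

lemma circ_part_mult_of_real: "circ_part \<epsilon> (w * complex_of_real r) = circ_part \<epsilon> w * r"
  by (simp add: circ_part_def)

lemma measurable_circ_part_Complex [measurable]:
  assumes [measurable]: "f \<in> borel_measurable M" "g \<in> borel_measurable M"
  shows "(\<lambda>x. circ_part \<epsilon> (Complex (f x) (g x) ^ n)) \<in> borel_measurable M"
  unfolding circ_part_def Complex_eq by measurable

lemma planar_radial:
  fixes \<epsilon> n a b :: nat
  defines "f \<equiv> \<lambda>y t. circ_part \<epsilon> (Complex y t ^ n) * (y ^ a * t ^ b)"
  shows "\<exists>c. (\<forall>\<Psi> \<in> borel_measurable borel. set_integrable lborel {0<..} (\<lambda>R. \<Psi> R * R ^ Suc (n + a + b)) \<longrightarrow>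
      (\<integral>t. \<integral>y. \<Psi> (sqrt (y\<^sup>2 + t\<^sup>2)) * f y t \<partial>lborel \<partial>lborel) =
        c * (LINT R:{0<..}|lborel. \<Psi> R * R ^ Suc (n + a + b))) \<and>
    (a + b < n \<or> odd (n + a + b) \<longrightarrow> c = 0)"
proof (intro exI conjI ballI impI)
  let ?N = "n + a + b"
  let ?c = "\<integral>u. f u 1 / sqrt (1 + u\<^sup>2) ^ (?N + 2) \<partial>lborel"
  have f[measurable]: "case_prod f \<in> borel_measurable (borel \<Otimes>\<^sub>M borel)"
    unfolding f_def by measurable
  have hom: "f (r * y) (r * t) = r ^ ?N * f y t" for r y t :: real
  proof -
    have "Complex (r * y) (r * t) = Complex y t * complex_of_real r"
      by (simp add: complex_eq_iff)
    then have "Complex (r * y) (r * t) ^ n = Complex y t ^ n * complex_of_real (r ^ n)"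
      by (simp add: power_mult_distrib)
    then have "circ_part \<epsilon> (Complex (r * y) (r * t) ^ n) = circ_part \<epsilon> (Complex y t ^ n) * r ^ n"
      by (simp only: circ_part_mult_of_real)
    then show ?thesis
      by (simp add: f_def power_mult_distrib power_add)
  qed
  have bound: "\<bar>f u 1\<bar> \<le> 1 * sqrt (1 + u\<^sup>2) ^ ?N" for u
  proof -
    have "norm (Complex u 1) = sqrt (1 + u\<^sup>2)"
      by (simp add: cmod_def add.commute)
    then have "\<bar>circ_part \<epsilon> (Complex u 1 ^ n)\<bar> \<le> sqrt (1 + u\<^sup>2) ^ n"
      using abs_circ_part_le[of \<epsilon> "Complex u 1 ^ n"] by (simp add: norm_power)
    moreover have "\<bar>u\<bar> ^ a \<le> sqrt (1 + u\<^sup>2) ^ a"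
      by (intro power_mono real_le_rsqrt) auto
    moreover have "1 \<le> sqrt (1 + u\<^sup>2) ^ b"
      by (intro one_le_power) simp
    ultimately have "\<bar>circ_part \<epsilon> (Complex u 1 ^ n)\<bar> * (\<bar>u\<bar> ^ a * 1) \<le>
        sqrt (1 + u\<^sup>2) ^ n * (sqrt (1 + u\<^sup>2) ^ a * sqrt (1 + u\<^sup>2) ^ b)"
      by (intro mult_mono) auto
    then show ?thesis
      by (simp add: f_def abs_mult power_abs power_add mult.assoc)
  qed
  {
    fix \<Psi> :: "real \<Rightarrow> real"
    assume \<Psi>[measurable]: "\<Psi> \<in> borel_measurable borel"
      and int: "set_integrable lborel {0<..} (\<lambda>R. \<Psi> R * R ^ Suc ?N)"
    let ?\<phi> = "\<lambda>t. \<integral>y. \<Psi> (sqrt (y\<^sup>2 + t\<^sup>2)) * f y t \<partial>lborel"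
    have par: "?\<phi> (- t) = (-1) ^ ?N * ?\<phi> t" for t
    proof -
      have "?\<phi> (- t) = (\<integral>y. \<Psi> (sqrt (y\<^sup>2 + t\<^sup>2)) * f (- y) (- t) \<partial>lborel)"
        using lborel_integral_real_affine[of "-1" "\<lambda>y. \<Psi> (sqrt (y\<^sup>2 + t\<^sup>2)) * f y (- t)" 0] by simp
      also have "\<dots> = (\<integral>y. (-1) ^ ?N * (\<Psi> (sqrt (y\<^sup>2 + t\<^sup>2)) * f y t) \<partial>lborel)"
        using hom[of "-1"] by (simp add: mult_ac)
      finally show ?thesis
        by simp
    qed
    have "(\<integral>t. ?\<phi> t \<partial>lborel) = (1 + (-1) ^ ?N) * (LINT t:{0<..}|lborel. ?\<phi> t)"
    proof (rule integral_lborel_radial_parity)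
      show "?\<phi> (- t) = (-1) ^ ?N * ?\<phi> t" for t
        by (rule par)
      show "set_integrable lborel {0<..} ?\<phi>"
        by (rule set_integrable_half_plane_radial[OF f \<Psi> hom bound int])
    qed measurable
    also have "(LINT t:{0<..}|lborel. ?\<phi> t) = ?c * (LINT R:{0<..}|lborel. \<Psi> R * R ^ Suc ?N)"
      by (rule set_integral_half_plane_radial[OF f \<Psi> hom bound int])
    finally show "(\<integral>t. ?\<phi> t \<partial>lborel) =
        (1 + (-1) ^ ?N) * ?c * (LINT R:{0<..}|lborel. \<Psi> R * R ^ Suc ?N)"
      by (simp only: mult.assoc)
  }
  show "(1 + (-1) ^ ?N) * ?c = 0" if "a + b < n \<or> odd ?N"
  proof (cases "odd ?N")
    case False
    let ?z = "\<lambda>u. cis_cot u ^ n * complex_of_real ((u / sqrt (1 + u\<^sup>2)) ^ a * (1 / sqrt (1 + u\<^sup>2)) ^ b / (1 + u\<^sup>2))"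
    have "f u 1 / sqrt (1 + u\<^sup>2) ^ (?N + 2) = circ_part \<epsilon> (?z u)" for u
    proof -
      define s where "s = sqrt (1 + u\<^sup>2)"
      have s: "s\<^sup>2 = 1 + u\<^sup>2"
        by (simp add: s_def)
      have "?z u = Complex u 1 ^ n * complex_of_real ((1 / s) ^ n) *
          complex_of_real ((u / s) ^ a * (1 / s) ^ b / (1 + u\<^sup>2))"
        by (simp add: cis_cot_def s_def[symmetric] power_divide)
      then have "circ_part \<epsilon> (?z u) = circ_part \<epsilon> (Complex u 1 ^ n) * (1 / s) ^ n * ((u / s) ^ a * (1 / s) ^ b / s\<^sup>2)"
        by (simp only: circ_part_mult_of_real s)
      also have "\<dots> = f u 1 / s ^ (?N + 2)"
        by (simp add: f_def power_divide power_add power2_eq_square)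
      finally show ?thesis
        by (simp add: s_def)
    qed
    then have "?c = circ_part \<epsilon> (\<integral>u. ?z u \<partial>lborel)"
      by (simp only: integral_bounded_linear[OF bounded_linear_circ_part integrable_cis_cot])
    also have "\<dots> = 0"
      using integral_cis_cot_eq_0[of a b n] False that by (simp add: circ_part_def)
    finally show ?thesis
      by simp
  qed simp
qed

lemma borel_measurable_poly [measurable]:
  fixes p :: "real poly"
  assumes "f \<in> borel_measurable M"
  shows "(\<lambda>x. poly p (f x)) \<in> borel_measurable M"
  using assms by (rule measurable_compose) (intro borel_measurable_continuous_onI continuous_intros)

lemma poly_bounded_unit_interval:
  fixes p :: "real poly"
  shows "\<exists>B\<ge>0. \<forall>t. \<bar>t\<bar> \<le> 1 \<longrightarrow> \<bar>poly p t\<bar> \<le> B"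
proof -
  have "compact (poly p ` {-1..1})"
    by (intro compact_continuous_image continuous_intros) simp
  then have "bounded (poly p ` {-1..1})"
    by (rule compact_imp_bounded)
  then obtain B where "B > 0" "\<And>t. t \<in> {-1..1} \<Longrightarrow> \<bar>poly p t\<bar> \<le> B"
    by (auto simp: bounded_pos)
  then show ?thesis
    by (intro exI[of _ B]) (auto simp: abs_le_iff)
qed

lemma abs_div_sqrt_less_1: "\<bar>u / sqrt (1 + u\<^sup>2)\<bar> < 1" for u :: real
proof -
  have pos: "0 < 1 + u\<^sup>2"
    by (simp add: add_pos_nonneg)
  have "\<bar>u\<bar> < sqrt (1 + u\<^sup>2)"
    by (rule real_less_rsqrt) simp
  then show ?thesis
    using pos by (simp add: abs_divide)
qed

lemma set_integrable_gegenbauer_weight: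
  fixes p :: "real poly"
  assumes "\<sigma> \<ge> 0"
  shows "set_integrable lborel {-1..1} (\<lambda>t. poly p t * (1 - t\<^sup>2) powr \<sigma>)"
proof -
  obtain B where B: "B \<ge> 0" "\<And>t. \<bar>t\<bar> \<le> 1 \<Longrightarrow> \<bar>poly p t\<bar> \<le> B"
    using poly_bounded_unit_interval[of p] by blast
  have int: "set_integrable lborel {-1..1} (\<lambda>t::real. B)"
    by (simp add: set_integrable_def)
  show ?thesis
  proof (rule set_integrable_bound[OF int])
    show "set_borel_measurable lborel {-1..1} (\<lambda>t. poly p t * (1 - t\<^sup>2) powr \<sigma>)"
      unfolding set_borel_measurable_def by measurable
    show "AE t in lborel. t \<in> {-1..1} \<longrightarrow> norm (poly p t * (1 - t\<^sup>2) powr \<sigma>) \<le> norm B"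
    proof (intro AE_I2 impI)
      fix t :: real
      assume t: "t \<in> {-1..1}"
      then have "t\<^sup>2 \<le> 1"
        by (simp add: abs_square_le_1 abs_le_iff)
      then have "(1 - t\<^sup>2) powr \<sigma> \<le> 1"
        using powr_mono2[of \<sigma> "1 - t\<^sup>2" 1] assms by simp
      then have "\<bar>poly p t\<bar> * (1 - t\<^sup>2) powr \<sigma> \<le> B * 1"
        using B t by (intro mult_mono) auto
      then show "norm (poly p t * (1 - t\<^sup>2) powr \<sigma>) \<le> norm B"
        using B by (simp add: abs_mult)
    qed
  qed
qed

lemma integral_cot_eq_gegenbauer:
  fixes p :: "real poly"
  assumes "e \<ge> 1"
  shows "(\<integral>u. poly p (u / sqrt (1 + u\<^sup>2)) / sqrt (1 + u\<^sup>2) ^ (e + 2) \<partial>lborel) =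
    (LBINT t:{-1..1}. poly p t * (1 - t\<^sup>2) powr ((real e - 1) / 2))"
proof -
  let ?\<sigma> = "(real e - 1) / 2"
  let ?g = "\<lambda>u::real. u / sqrt (1 + u\<^sup>2)"
  let ?g' = "\<lambda>u::real. 1 / sqrt (1 + u\<^sup>2) ^ 3"
  let ?f = "\<lambda>t. poly p t * (1 - t\<^sup>2) powr ?\<sigma>"
  let ?h = "\<lambda>u. poly p (?g u) / sqrt (1 + u\<^sup>2) ^ (e + 2)"
  have pos: "0 < 1 + u\<^sup>2" for u :: real
    by (simp add: add_pos_nonneg)
  have sub: "?g' u *\<^sub>R ?f (?g u) = ?h u" for u
  proof -
    define s where "s = sqrt (1 + u\<^sup>2)"
    have s: "s > 0" "s\<^sup>2 = 1 + u\<^sup>2"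
      using pos[of u] by (auto simp: s_def)
    have "1 - (u / s)\<^sup>2 = (s\<^sup>2 - u\<^sup>2) / s\<^sup>2"
      using s(1) by (simp add: power_divide diff_divide_distrib)
    also have "\<dots> = inverse s ^ 2"
      by (simp add: s(2) power_inverse divide_inverse)
    also have "inverse s ^ 2 = inverse s powr 2"
      using s(1) by simp
    also have "\<dots> powr ?\<sigma> = inverse s powr real (e - 1)"
      unfolding powr_powr using assms by (simp add: of_nat_diff diff_divide_distrib)
    also have "\<dots> = inverse s ^ (e - 1)"
      using s(1) by (intro powr_realpow) simp
    finally have "?g' u *\<^sub>R ?f (?g u) = 1 / s ^ 3 * (poly p (u / s) * inverse s ^ (e - 1))"
      by (simp only: s_def real_scaleR_def)
    then have "?g' u *\<^sub>R ?f (?g u) = poly p (u / s) / (s ^ 3 * s ^ (e - 1))"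
      by (simp add: power_inverse field_simps)
    also have "s ^ 3 * s ^ (e - 1) = s ^ (e + 2)"
      using assms by (simp flip: power_add)
    finally show ?thesis
      by (simp add: s_def)
  qed
  have lim: "((\<lambda>u. ?g u) \<longlongrightarrow> 1) at_top"
  proof -
    have "((\<lambda>u::real. 1 / sqrt (inverse u ^ 2 + 1)) \<longlongrightarrow> 1 / sqrt (0 ^ 2 + 1)) at_top"
      by (intro tendsto_intros tendsto_inverse_0_at_top filterlim_ident) auto
    moreover have "\<forall>\<^sub>F u in at_top. 1 / sqrt (inverse u ^ 2 + 1) = ?g u"
      using eventually_gt_at_top[of 0]
    proof eventually_elim
      case (elim u)
      have "inverse u ^ 2 + 1 = (1 + u\<^sup>2) / u\<^sup>2"
        using elim by (simp add: field_simps)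
      then show ?case
        using elim by (simp add: real_sqrt_divide)
    qed
    ultimately show ?thesis
      by (simp add: tendsto_cong)
  qed
  have lim': "((\<lambda>u. ?g u) \<longlongrightarrow> - 1) at_bot"
    unfolding filterlim_at_bot_mirror using tendsto_minus[OF lim] by simp
  obtain B where B: "B \<ge> 0" "\<And>t. \<bar>t\<bar> \<le> 1 \<Longrightarrow> \<bar>poly p t\<bar> \<le> B"
    using poly_bounded_unit_interval[of p] by blast
  have h: "integrable lborel ?h"
  proof (rule Bochner_Integration.integrable_bound[OF integrable_mult_right[OF integrable_inverse_1_plus_square, of B]])
    show "AE u in lborel. norm (?h u) \<le> norm (B * (1 / (1 + u\<^sup>2)))"
    proof (rule AE_I2)
      fix u :: real
      define s where "s = sqrt (1 + u\<^sup>2)"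
      have s: "s > 0" "s \<ge> 1" "s\<^sup>2 = 1 + u\<^sup>2"
        using pos[of u] by (auto simp: s_def)
      have "\<bar>poly p (u / s)\<bar> \<le> B"
        using abs_div_sqrt_less_1[of u] by (intro B) (simp add: s_def)
      moreover have "1 * s\<^sup>2 \<le> s ^ (e + 2)"
        unfolding power_add using s(2) by (intro mult_right_mono one_le_power) auto
      ultimately have "\<bar>poly p (u / s)\<bar> / s ^ (e + 2) \<le> B / s\<^sup>2"
        by (intro frac_le) (use s(1) B(1) in auto)
      then show "norm (?h u) \<le> norm (B * (1 / (1 + u\<^sup>2)))"
        using s(1,3) B by (simp add: s_def[symmetric] abs_divide power_abs)
    qed
  qed measurable
  have int: "set_integrable lborel (einterval (-1) 1) ?f"
  proof (rule set_integrable_subset)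
    show "set_integrable lborel {-1..1} ?f"
      using assms by (intro set_integrable_gegenbauer_weight) simp
    show "einterval (-1) 1 \<subseteq> {-1..(1::real)}"
      by (auto simp: one_ereal_def)
  qed simp
  have "(LBINT t=-1..1. ?f t) = (LBINT u=-\<infinity>..\<infinity>. ?g' u *\<^sub>R ?f (?g u))"
  proof (rule interval_integral_substitution_integrable)
    fix u :: real
    define s where "s = sqrt (1 + u\<^sup>2)"
    have s: "s > 0" "s * s = 1 + u\<^sup>2"
      using pos[of u] by (auto simp: s_def)
    have sqrt': "((\<lambda>u. sqrt (1 + u\<^sup>2)) has_real_derivative u / s) (at u)"
      using pos[of u] by (auto intro!: derivative_eq_intros simp: s_def field_simps)
    have "(?g has_real_derivative (1 * s - u * (u / s)) / (s * s)) (at u)"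
      unfolding s_def using pos[of u]
      by (intro DERIV_divide DERIV_ident sqrt'[unfolded s_def]) auto
    also have "(1 * s - u * (u / s)) / (s * s) = (s * s - u\<^sup>2) / s ^ 3"
      using s(1) by (simp add: field_simps power2_eq_square power3_eq_cube)
    finally show "DERIV ?g u :> ?g' u"
      using s(2) by (simp add: s_def)
    have "(?g u)\<^sup>2 < 1"
      using abs_div_sqrt_less_1[of u] by (simp add: abs_square_less_1)
    then show "isCont ?f (?g u)"
      by (intro continuous_intros) auto
    show "isCont ?g' u"
      using pos[of u] by (intro continuous_intros) auto
  next
    show "((ereal \<circ> ?g \<circ> real_of_ereal) \<longlongrightarrow> 1) (at_left \<infinity>)"
      unfolding ereal_tendsto_simps using lim by (simp add: comp_def one_ereal_def)
    show "((ereal \<circ> ?g \<circ> real_of_ereal) \<longlongrightarrow> -1) (at_right (-\<infinity>))"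
      unfolding ereal_tendsto_simps using lim' by (simp add: comp_def one_ereal_def)
    show "set_integrable lborel (einterval (-\<infinity>) \<infinity>) (\<lambda>u. ?g' u *\<^sub>R ?f (?g u))"
      using h unfolding sub by (simp add: set_integrable_def)
  qed (use int in auto)
  also have "\<dots> = (\<integral>u. ?h u \<partial>lborel)"
    unfolding sub by (simp add: interval_lebesgue_integral_def set_lebesgue_integral_def)
  finally show ?thesis
    by (simp add: interval_integral_Icc one_ereal_def)
qed

lemma gegenbauer_parity:
  assumes geg: "is_gegenbauer lam n p" and lam: "lam \<ge> 1 / 2"
  shows "poly p (- t) = (-1) ^ n * poly p t"
proof -
  let ?w = "\<lambda>t::real. (1 - t\<^sup>2) powr (lam - 1 / 2)"
  define r where "r = p \<circ>\<^sub>p [:0, -1:]"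
  define D where "D = r - smult ((-1) ^ n) p"
  have p: "degree p = n" "p \<noteq> 0"
    and orth: "\<And>q. degree q < n \<Longrightarrow> (LBINT t:{-1..1}. poly p t * poly q t * ?w t) = 0"
    using geg by (auto simp: is_gegenbauer_def)
  have poly_r: "poly r t = poly p (- t)" for t
    by (simp add: r_def poly_pcompose)
  have "D = 0"
  proof (rule ccontr)
    assume D: "D \<noteq> 0"
    have deg_r: "degree r = n"
      by (simp add: r_def p degree_pcompose)
    have lead: "coeff r n = (-1) ^ n * coeff p n"
      using lead_coeff_comp[of "[:0, -1::real:]" p] deg_r by (simp add: r_def p)
    have "degree D \<le> n"
      unfolding D_def by (rule degree_diff_le) (simp_all add: deg_r p)
    moreover have "coeff D n = 0"
      by (simp add: D_def lead)
    ultimately have deg: "degree D < n"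
      using D by (metis le_neq_implies_less leading_coeff_0_iff)
    have int: "set_integrable lborel {-1..1} (\<lambda>t. poly q t * ?w t)" for q
      using lam by (intro set_integrable_gegenbauer_weight) simp
    have 1: "(LBINT t:{-1..1}. poly p t * poly D t * ?w t) = 0"
      by (rule orth[OF deg])
    have "(LBINT t:{-1..1}. poly r t * poly D t * ?w t) =
        (LBINT t:{-1..1}. poly r (- t) * poly D (- t) * ?w (- t))"
    proof -
      have "indicator {-1..1} (- x) = (indicator {-1..1} x :: real)" for x :: real
        by (auto simp: indicator_def)
      then show ?thesis
        unfolding set_lebesgue_integral_def
        by (subst lborel_integral_real_affine[of "-1" _ 0]) simp_all
    qed
    also have "\<dots> = (LBINT t:{-1..1}. poly p t * poly (D \<circ>\<^sub>p [:0, -1:]) t * ?w t)"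
      by (simp add: poly_r poly_pcompose)
    also have "\<dots> = 0"
      using deg by (intro orth) (simp add: degree_pcompose)
    finally have 2: "(LBINT t:{-1..1}. poly r t * poly D t * ?w t) = 0" .
    have "(LBINT t:{-1..1}. poly (D * D) t * ?w t) =
      (LBINT t:{-1..1}. poly (r * D) t * ?w t - (-1) ^ n * (poly (p * D) t * ?w t))"
      by (intro set_lebesgue_integral_cong) (auto simp: D_def algebra_simps)
    also have "\<dots> = (LBINT t:{-1..1}. poly (r * D) t * ?w t) - (-1) ^ n * (LBINT t:{-1..1}. poly (p * D) t * ?w t)"
      using int[of "r * D"] int[of "p * D"]
      by (subst set_integral_diff(2)) auto
    also have "\<dots> = 0"
      using 1 2 by simp
    finally have zero: "(LBINT t:{-1..1}. poly (D * D) t * ?w t) = 0" .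
    have "AE t in lborel. indicator {-1..1} t *\<^sub>R (poly (D * D) t * ?w t) = 0"
      using zero int[of "D * D"] unfolding set_lebesgue_integral_def set_integrable_def
      by (subst (asm) integral_nonneg_eq_0_iff_AE) (auto simp: indicator_def)
    moreover have "AE t in lborel. t \<notin> {t. poly D t = 0}"
    proof (rule AE_not_in)
      have "finite {t. poly D t = 0}"
        using D by (rule poly_roots_finite)
      then show "{t. poly D t = 0} \<in> null_sets lborel"
        by (rule finite_imp_null_set_lborel)
    qed
    ultimately have "AE t in lborel. t \<notin> {-1<..<(1::real)}"
    proof eventually_elim
      case (elim t)
      show ?case
      proof
        assume t: "t \<in> {-1<..<1}"
        then have "t\<^sup>2 < 1"
          by (simp add: abs_square_less_1 abs_less_iff)
        with elim t show False
          by auto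
      qed
    qed
    then have "{-1<..<(1::real)} \<in> null_sets lborel"
      by (subst AE_iff_null_sets[of _ lborel]) auto
    then show False
      by (simp add: null_sets_def)
  qed
  then show ?thesis
    using poly_r[of t] by (simp add: D_def)
qed

lemma gegenbauer_moment_eq_0:
  assumes geg: "is_gegenbauer lam n p" and lam: "lam \<ge> 1 / 2"
    and a: "a + 2 * q < n \<or> odd (a + n)"
  shows "(LBINT t:{-1..1}. poly (p * monom 1 a) t * (1 - t\<^sup>2) powr (real q + lam - 1 / 2)) = 0"
proof -
  let ?w = "\<lambda>t::real. (1 - t\<^sup>2) powr (lam - 1 / 2)"
  let ?Q = "monom 1 a * [:1, 0, -1:] ^ q :: real poly"
  have eq: "(LBINT t:{-1..1}. poly (p * monom 1 a) t * (1 - t\<^sup>2) powr (real q + lam - 1 / 2)) =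
      (LBINT t:{-1..1}. poly p t * poly ?Q t * ?w t)"
    unfolding set_lebesgue_integral_def
  proof (rule integral_cong_AE)
    show "AE t in lborel. indicator {-1..1} t *\<^sub>R (poly (p * monom 1 a) t * (1 - t\<^sup>2) powr (real q + lam - 1 / 2)) =
        indicator {-1..1} t *\<^sub>R (poly p t * poly ?Q t * ?w t)"
      using AE_lborel_singleton[of 1] AE_lborel_singleton[of "-1"]
    proof eventually_elim
      case (elim t)
      show ?case
      proof (cases "t \<in> {-1..1}")
        case True
        then have "t\<^sup>2 < 1"
          using elim by (simp add: abs_square_less_1 abs_less_iff)
        then have "(1 - t\<^sup>2) powr (real q + lam - 1 / 2) = (1 - t\<^sup>2) ^ q * ?w t"
          by (simp add: add_diff_eq[symmetric] powr_add powr_realpow)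
        then show ?thesis
          by (simp add: poly_monom power2_eq_square)
      qed simp
    qed
  qed measurable
  show ?thesis
    using a
  proof
    assume "a + 2 * q < n"
    moreover have "degree ?Q \<le> a + 2 * q"
    proof -
      have "degree ?Q \<le> degree (monom 1 a :: real poly) + degree ([:1, 0, -1:] ^ q :: real poly)"
        by (rule degree_mult_le)
      also have "\<dots> \<le> a + 2 * q"
        using degree_power_le[of "[:1, 0, -1::real:]" q] by (intro add_mono degree_monom_le) simp
      finally show ?thesis .
    qed
    ultimately have "degree ?Q < n"
      by simp
    with geg have "(LBINT t:{-1..1}. poly p t * poly ?Q t * ?w t) = 0"
      unfolding is_gegenbauer_def by blast
    then show ?thesis
      by (simp only: eq)
  next
    assume odd: "odd (a + n)"
    let ?I = "LBINT t:{-1..1}. poly p t * poly ?Q t * ?w t"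
    have "?I = (LBINT t:{-1..1}. - (poly p t * poly ?Q t * ?w t))"
      unfolding set_lebesgue_integral_def
    proof (subst lborel_integral_real_affine[of "-1" _ 0])
      have "((-1) ^ n * (-1) ^ a :: real) = -1"
        using odd by (simp add: power_add[symmetric] add.commute)
      moreover have "poly p (- t) * poly ?Q (- t) = ((-1) ^ n * (-1) ^ a) * (poly p t * poly ?Q t)" for t
        unfolding gegenbauer_parity[OF geg lam]
        by (simp add: poly_monom power_minus[of t] mult_ac)
      ultimately have "poly p (- t) * poly ?Q (- t) = - (poly p t * poly ?Q t)" for t
        by simp
      then show "\<bar>- 1\<bar> *\<^sub>R (LBINT x. indicator {- 1..1} (0 + - 1 * x) *\<^sub>R
          (poly p (0 + - 1 * x) * poly ?Q (0 + - 1 * x) * (1 - (0 + - 1 * x)\<^sup>2) powr (lam - 1 / 2))) =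
        (LBINT t. indicator {- 1..1} t *\<^sub>R - (poly p t * poly ?Q t * ?w t))"
        by (auto intro!: Bochner_Integration.integral_cong simp: indicator_def)
    qed simp
    then show ?thesis
      unfolding eq by (simp add: set_lebesgue_integral_def)
  qed
qed

section \<open>Integrals of solid harmonics against radial functions\<close>

definition solid_harm :: "(nat \<Rightarrow> real poly) \<Rightarrow> nat \<Rightarrow> (nat \<Rightarrow> nat) \<Rightarrow> nat \<Rightarrow> (nat \<Rightarrow> real) \<Rightarrow> real" where
  "solid_harm P d m s x =
     (\<Prod>k = s..d - 2. L2_set x {k..d} ^ m k * poly (P k) (x k / L2_set x {k..d})) *
     circ_part (m d) (Complex (x (d - 1)) (x d) ^ (m (d - 1) + m d))"

lemma L2_set_subset_mono:
  assumes "finite I" "J \<subseteq> I"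
  shows "L2_set x J \<le> L2_set x I"
  unfolding L2_set_def using assms by (intro real_sqrt_le_mono sum_mono2) auto

lemma abs_le_L2_set:
  assumes "finite I" "i \<in> I"
  shows "\<bar>x i\<bar> \<le> L2_set x I"
  using L2_set_subset_mono[of I "{i}" x] assms by simp

lemma solid_harm_bound:
  assumes "2 \<le> d" "s \<le> d - 1"
  obtains K where "\<And>x. \<bar>solid_harm P d m s x * (\<Prod>i = s..d. x i ^ a i)\<bar> \<le>
    K * L2_set x {s..d} ^ (\<Sum>i = s..d. m i + a i)"
proof -
  obtain D where d: "d = Suc (Suc D)"
    using le_Suc_ex[OF assms(1)] by auto
  from poly_bounded_unit_interval have "\<forall>k. \<exists>B\<ge>0. \<forall>t. \<bar>t\<bar> \<le> 1 \<longrightarrow> \<bar>poly (P k) t\<bar> \<le> B" ..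
  from choice[OF this] obtain B where
    "\<forall>k. 0 \<le> B k \<and> (\<forall>t. \<bar>t\<bar> \<le> 1 \<longrightarrow> \<bar>poly (P k) t\<bar> \<le> B k)" ..
  then have B: "\<And>k. 0 \<le> B k" "\<And>k t. \<bar>t\<bar> \<le> 1 \<Longrightarrow> \<bar>poly (P k) t\<bar> \<le> B k"
    by simp_all
  show ?thesis
  proof
    fix x :: "nat \<Rightarrow> real"
    define r where "r = L2_set x {s..d}"
    have r: "r \<ge> 0"
      by (simp add: r_def)
    have "\<bar>\<Prod>k = s..d - 2. L2_set x {k..d} ^ m k * poly (P k) (x k / L2_set x {k..d})\<bar> \<le>
        (\<Prod>k = s..d - 2. r ^ m k * B k)"
      unfolding abs_prod
    proof (intro prod_mono conjI)
      fix k
      assume k: "k \<in> {s..d - 2}"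
      have "L2_set x {k..d} \<le> r"
        unfolding r_def using k by (intro L2_set_subset_mono) auto
      then have "L2_set x {k..d} ^ m k \<le> r ^ m k"
        by (intro power_mono) auto
      moreover have "\<bar>x k\<bar> \<le> L2_set x {k..d}"
        using k assms by (intro abs_le_L2_set) auto
      then have "\<bar>poly (P k) (x k / L2_set x {k..d})\<bar> \<le> B k"
        by (intro B) (auto simp: abs_divide divide_le_eq_1 abs_le_iff)
      ultimately show "\<bar>L2_set x {k..d} ^ m k * poly (P k) (x k / L2_set x {k..d})\<bar> \<le> r ^ m k * B k"
        using r unfolding abs_mult by (intro mult_mono) auto
    qed simp
    moreover have "\<bar>circ_part (m d) (Complex (x (d - 1)) (x d) ^ (m (d - 1) + m d))\<bar> \<le> r ^ (m (d - 1) + m d)"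
    proof -
      have "norm (Complex (x (d - 1)) (x d)) = L2_set x {d - 1, d}"
        using assms by (simp add: cmod_def)
      also have "\<dots> \<le> r"
        unfolding r_def using assms by (intro L2_set_subset_mono) auto
      finally have "norm (Complex (x (d - 1)) (x d) ^ (m (d - 1) + m d)) \<le> r ^ (m (d - 1) + m d)"
        unfolding norm_power by (intro power_mono) auto
      then show ?thesis
        using abs_circ_part_le order_trans by blast
    qed
    moreover have "\<bar>\<Prod>i = s..d. x i ^ a i\<bar> \<le> (\<Prod>i = s..d. r ^ a i)"
      unfolding abs_prod r_def
      by (intro prod_mono) (auto simp: power_abs intro!: power_mono abs_le_L2_set)
    ultimately have "\<bar>solid_harm P d m s x * (\<Prod>i = s..d. x i ^ a i)\<bar> \<le>
      ((\<Prod>k = s..d - 2. r ^ m k * B k) * r ^ (m (d - 1) + m d)) * (\<Prod>i = s..d. r ^ a i)"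
      unfolding solid_harm_def abs_mult using r B
      by (intro mult_mono) (auto intro!: mult_nonneg_nonneg prod_nonneg)
    also have "\<dots> = (\<Prod>k = s..d - 2. B k) *
        ((\<Prod>k = s..d - 2. r ^ m k) * r ^ (m (d - 1) + m d) * (\<Prod>i = s..d. r ^ a i))"
      by (simp add: prod.distrib mult_ac)
    also have "(\<Prod>k = s..d - 2. r ^ m k) * r ^ (m (d - 1) + m d) * (\<Prod>i = s..d. r ^ a i) =
        r ^ (\<Sum>i = s..d. m i + a i)"
      using assms by (simp add: d power_sum[symmetric] power_add[symmetric] sum.distrib add_ac)
    finally show "\<bar>solid_harm P d m s x * (\<Prod>i = s..d. x i ^ a i)\<bar> \<le>
        (\<Prod>k = s..d - 2. B k) * L2_set x {s..d} ^ (\<Sum>i = s..d. m i + a i)"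
      by (simp add: r_def)
  qed
qed

lemma measurable_solid_harm:
  assumes "2 \<le> d" "s \<le> d - 1"
  shows "(\<lambda>x. solid_harm P d m s x * (\<Prod>i = s..d. x i ^ a i)) \<in>
    borel_measurable (Pi\<^sub>M {s..d} (\<lambda>_. lborel))"
proof -
  let ?M = "Pi\<^sub>M {s..d} (\<lambda>_. lborel :: real measure)"
  have comp: "(\<lambda>x. x k) \<in> borel_measurable ?M" if "k \<in> {s..d}" for k
    using that by measurable
  have L2: "(\<lambda>x. L2_set x {k..d}) \<in> borel_measurable ?M" if "k \<in> {s..d}" for k
    using that by (intro measurable_L2_set_PiM) auto
  show ?thesis
    unfolding solid_harm_def using assms
    by (intro borel_measurable_times borel_measurable_prod borel_measurable_power
        borel_measurable_poly borel_measurable_divide measurable_circ_part_Complex comp L2) auto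
qed

lemma solid_harm_fun_upd:
  assumes "s < d - 1"
  defines "R \<equiv> \<lambda>x y. sqrt (y\<^sup>2 + (L2_set x {Suc s..d})\<^sup>2)"
  shows "L2_set (x(s := y)) {s..d} = R x y"
    and "solid_harm P d m s (x(s := y)) * (\<Prod>i = s..d. (x(s := y)) i ^ a i) =
      (R x y ^ m s * poly (P s) (y / R x y) * y ^ a s) *
      (solid_harm P d m (Suc s) x * (\<Prod>i = Suc s..d. x i ^ a i))"
proof -
  have ins: "{s..d} = insert s {Suc s..d}" "{s..d - 2} = insert s {Suc s..d - 2}"
    using assms(1) by auto
  show R: "L2_set (x(s := y)) {s..d} = R x y"
    unfolding ins(1) R_def by (rule L2_set_fun_upd_insert) auto
  have L2: "L2_set (x(s := y)) {k..d} = L2_set x {k..d}" if "k \<in> {Suc s..d}" for k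
    using that by (intro L2_set_cong) auto
  have "(\<Prod>i = s..d. (x(s := y)) i ^ a i) = y ^ a s * (\<Prod>i = Suc s..d. (x(s := y)) i ^ a i)"
    unfolding ins(1) by (subst prod.insert) auto
  also have "(\<Prod>i = Suc s..d. (x(s := y)) i ^ a i) = (\<Prod>i = Suc s..d. x i ^ a i)"
    by (intro prod.cong) auto
  finally have mono: "(\<Prod>i = s..d. (x(s := y)) i ^ a i) = y ^ a s * (\<Prod>i = Suc s..d. x i ^ a i)" .
  have "(\<Prod>k = s..d - 2. L2_set (x(s := y)) {k..d} ^ m k *
      poly (P k) ((x(s := y)) k / L2_set (x(s := y)) {k..d})) =
    (R x y ^ m s * poly (P s) (y / R x y)) * (\<Prod>k = Suc s..d - 2. L2_set (x(s := y)) {k..d} ^ m k *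
      poly (P k) ((x(s := y)) k / L2_set (x(s := y)) {k..d}))"
    unfolding ins(2) by (subst prod.insert) (auto simp: R)
  also have "(\<Prod>k = Suc s..d - 2. L2_set (x(s := y)) {k..d} ^ m k *
      poly (P k) ((x(s := y)) k / L2_set (x(s := y)) {k..d})) =
      (\<Prod>k = Suc s..d - 2. L2_set x {k..d} ^ m k * poly (P k) (x k / L2_set x {k..d}))"
    by (intro prod.cong refl) (auto simp: L2)
  finally have prod: "(\<Prod>k = s..d - 2. L2_set (x(s := y)) {k..d} ^ m k *
      poly (P k) ((x(s := y)) k / L2_set (x(s := y)) {k..d})) =
    R x y ^ m s * poly (P s) (y / R x y) *
      (\<Prod>k = Suc s..d - 2. L2_set x {k..d} ^ m k * poly (P k) (x k / L2_set x {k..d}))" .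
  have circ: "Complex ((x(s := y)) (d - 1)) ((x(s := y)) d) = Complex (x (d - 1)) (x d)"
    using assms(1) by auto
  have "solid_harm P d m s (x(s := y)) = R x y ^ m s * poly (P s) (y / R x y) * solid_harm P d m (Suc s) x"
    unfolding solid_harm_def prod circ by (simp only: mult.assoc)
  then show "solid_harm P d m s (x(s := y)) * (\<Prod>i = s..d. (x(s := y)) i ^ a i) =
      (R x y ^ m s * poly (P s) (y / R x y) * y ^ a s) *
      (solid_harm P d m (Suc s) x * (\<Prod>i = Suc s..d. x i ^ a i))"
    by (simp only: mono mult_ac)
qed

lemma integrable_solid_harm:
  assumes "2 \<le> d" "s \<le> d - 1" and \<Psi>: "\<Psi> \<in> borel_measurable borel"
    and int: "set_integrable lborel {0<..} (\<lambda>t. \<Psi> t * t ^ ((\<Sum>i = s..d. m i + a i) + (d - s)))"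
  shows "integrable (Pi\<^sub>M {s..d} (\<lambda>_. lborel))
    (\<lambda>x. \<Psi> (L2_set x {s..d}) * (solid_harm P d m s x * (\<Prod>i = s..d. x i ^ a i)))"
proof -
  obtain K where K: "\<And>x. \<bar>solid_harm P d m s x * (\<Prod>i = s..d. x i ^ a i)\<bar> \<le>
    K * L2_set x {s..d} ^ (\<Sum>i = s..d. m i + a i)"
    using solid_harm_bound[OF assms(1,2)] by blast
  show ?thesis
    by (rule integrable_radial[OF _ _ measurable_solid_harm[OF assms(1,2)] \<Psi> K])
       (use int assms(1,2) in \<open>auto simp: Suc_diff_le\<close>)
qed

definition degenerate :: "nat \<Rightarrow> (nat \<Rightarrow> nat) \<Rightarrow> (nat \<Rightarrow> nat) \<Rightarrow> nat \<Rightarrow> bool" where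
  "degenerate d m a s \<longleftrightarrow> (\<Sum>i = s..d. a i) < (\<Sum>i = s..d. m i) \<or> odd (\<Sum>i = s..d. m i + a i)"

lemma integral_solid_harm:
  assumes d: "2 \<le> d" and s: "1 \<le> s" "s \<le> d - 1"
    and geg: "\<And>k. k \<in> {1..d - 2} \<Longrightarrow> is_gegenbauer (sph_lambda d m k) (m k) (P k)"
  shows "\<exists>c. (\<forall>\<Psi> \<in> borel_measurable borel.
      set_integrable lborel {0<..} (\<lambda>t. \<Psi> t * t ^ ((\<Sum>i = s..d. m i + a i) + (d - s))) \<longrightarrow>
      (\<integral>x. \<Psi> (L2_set x {s..d}) * (solid_harm P d m s x * (\<Prod>i = s..d. x i ^ a i)) \<partial>Pi\<^sub>M {s..d} (\<lambda>_. lborel)) =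
        c * (LINT t:{0<..}|lborel. \<Psi> t * t ^ ((\<Sum>i = s..d. m i + a i) + (d - s)))) \<and>
    ((\<exists>k\<in>{s..d - 1}. degenerate d m a k) \<longrightarrow> c = 0)"
  using s(2,1)
proof (induction s rule: inc_induct)
  case base
  obtain D where D: "d = Suc (Suc D)"
    using le_Suc_ex[OF d] by auto
  define n where "n = m (d - 1) + m d"
  let ?f = "\<lambda>y t. circ_part (m d) (Complex y t ^ n) * (y ^ a (d - 1) * t ^ a d)"
  obtain c where c: "\<And>\<Psi>. \<Psi> \<in> borel_measurable borel \<Longrightarrow>
      set_integrable lborel {0<..} (\<lambda>R. \<Psi> R * R ^ Suc (n + a (d - 1) + a d)) \<Longrightarrow>
      (\<integral>t. \<integral>y. \<Psi> (sqrt (y\<^sup>2 + t\<^sup>2)) * ?f y t \<partial>lborel \<partial>lborel) =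
        c * (LINT R:{0<..}|lborel. \<Psi> R * R ^ Suc (n + a (d - 1) + a d))"
    and c0: "a (d - 1) + a d < n \<or> odd (n + a (d - 1) + a d) \<Longrightarrow> c = 0"
    using planar_radial[of n "a (d - 1)" "a d" "m d"] by blast
  have exp: "(\<Sum>i = d - 1..d. m i + a i) + (d - (d - 1)) = Suc (n + a (d - 1) + a d)"
    by (simp add: D n_def)
  have L2: "L2_set x {d - 1..d} = sqrt ((x (d - 1))\<^sup>2 + (x d)\<^sup>2)" for x
    by (simp add: L2_set_def D)
  have ins: "{d - 1..d} = insert (d - 1) {d}" "d - 1 \<notin> {d}"
    by (auto simp: D)
  show ?case
    unfolding exp
  proof (intro exI conjI ballI impI)
    show "c = 0" if "\<exists>k\<in>{d - 1..d - 1}. degenerate d m a k"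
      using that by (intro c0) (auto simp: degenerate_def D n_def add_ac)
    fix \<Psi> :: "real \<Rightarrow> real"
    assume \<Psi>[measurable]: "\<Psi> \<in> borel_measurable borel"
      and int: "set_integrable lborel {0<..} (\<lambda>R. \<Psi> R * R ^ Suc (n + a (d - 1) + a d))"
    let ?F = "\<lambda>x. \<Psi> (L2_set x {d - 1..d}) * (solid_harm P d m (d - 1) x * (\<Prod>i = d - 1..d. x i ^ a i))"
    have "integrable (Pi\<^sub>M {d - 1..d} (\<lambda>_. lborel)) ?F"
      using int by (intro integrable_solid_harm) (simp_all only: exp \<Psi> d order_refl)
    then have "(\<integral>x. ?F x \<partial>Pi\<^sub>M {d - 1..d} (\<lambda>_. lborel)) =
        (\<integral>x. \<integral>y. ?F (x(d - 1 := y)) \<partial>lborel \<partial>Pi\<^sub>M {d} (\<lambda>_. lborel))"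
      unfolding ins(1) by (intro lborel_PiM.product_integral_insert ins(2)) simp
    also have "\<dots> = (\<integral>x. (\<lambda>t. \<integral>y. \<Psi> (sqrt (y\<^sup>2 + t\<^sup>2)) * ?f y t \<partial>lborel) (x d) \<partial>Pi\<^sub>M {d} (\<lambda>_. lborel))"
      unfolding L2 by (simp add: D solid_harm_def n_def)
    also have "\<dots> = (\<integral>t. \<integral>y. \<Psi> (sqrt (y\<^sup>2 + t\<^sup>2)) * ?f y t \<partial>lborel \<partial>lborel)"
      by (rule lborel_PiM.product_integral_singleton) measurable
    also have "\<dots> = c * (LINT R:{0<..}|lborel. \<Psi> R * R ^ Suc (n + a (d - 1) + a d))"
      by (rule c[OF \<Psi> int])
    finally show "(\<integral>x. ?F x \<partial>Pi\<^sub>M {d - 1..d} (\<lambda>_. lborel)) =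
      c * (LINT R:{0<..}|lborel. \<Psi> R * R ^ Suc (n + a (d - 1) + a d))" .
  qed
next
  case (step s)
  define e where "e = (\<Sum>i = Suc s..d. m i + a i) + (d - Suc s)"
  define N where "N = m s + a s + e"
  from step obtain c where IH: "\<And>\<Psi>. \<Psi> \<in> borel_measurable borel \<Longrightarrow>
      set_integrable lborel {0<..} (\<lambda>t. \<Psi> t * t ^ e) \<Longrightarrow>
      (\<integral>x. \<Psi> (L2_set x {Suc s..d}) * (solid_harm P d m (Suc s) x * (\<Prod>i = Suc s..d. x i ^ a i))
         \<partial>Pi\<^sub>M {Suc s..d} (\<lambda>_. lborel)) = c * (LINT t:{0<..}|lborel. \<Psi> t * t ^ e)"
    and c0: "\<exists>k\<in>{Suc s..d - 1}. degenerate d m a k \<Longrightarrow> c = 0"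
    unfolding e_def by auto
  have exp: "(\<Sum>i = s..d. m i + a i) + (d - s) = Suc N"
    using step.hyps by (simp add: N_def e_def sum.atLeast_Suc_atMost)
  have e1: "e \<ge> 1"
    using step.hyps by (simp add: e_def)
  have s2: "s \<in> {1..d - 2}"
    using step by auto
  have ins: "{s..d} = insert s {Suc s..d}"
    using step.hyps by auto
  let ?h = "\<lambda>y t. sqrt (y\<^sup>2 + t\<^sup>2) ^ m s * poly (P s) (y / sqrt (y\<^sup>2 + t\<^sup>2)) * y ^ a s"
  let ?f = "\<lambda>y t. ?h y t * t ^ e"
  let ?c = "\<integral>u. ?f u 1 / sqrt (1 + u\<^sup>2) ^ (N + 2) \<partial>lborel"
  have f[measurable]: "case_prod ?f \<in> borel_measurable (borel \<Otimes>\<^sub>M borel)"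
    by measurable
  have hom: "?f (r * y) (r * t) = r ^ N * ?f y t" if "r > 0" for r y t :: real
  proof -
    have "(r * y)\<^sup>2 + (r * t)\<^sup>2 = r\<^sup>2 * (y\<^sup>2 + t\<^sup>2)"
      by (simp add: power_mult_distrib distrib_left)
    then have "sqrt ((r * y)\<^sup>2 + (r * t)\<^sup>2) = r * sqrt (y\<^sup>2 + t\<^sup>2)"
      using that by (simp add: real_sqrt_mult)
    then show ?thesis
      using that by (simp add: power_mult_distrib N_def power_add)
  qed
  obtain B where B: "B \<ge> 0" "\<And>t. \<bar>t\<bar> \<le> 1 \<Longrightarrow> \<bar>poly (P s) t\<bar> \<le> B"
    using poly_bounded_unit_interval[of "P s"] by blast
  have bound: "\<bar>?f u 1\<bar> \<le> B * sqrt (1 + u\<^sup>2) ^ N" for u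
  proof -
    define r where "r = sqrt (1 + u\<^sup>2)"
    have r: "r \<ge> 1"
      by (simp add: r_def)
    have "\<bar>poly (P s) (u / r)\<bar> \<le> B"
      using abs_div_sqrt_less_1[of u] by (intro B) (simp add: r_def)
    moreover have "\<bar>u\<bar> ^ a s \<le> r ^ a s"
      unfolding r_def by (intro power_mono real_le_rsqrt) auto
    moreover have "1 \<le> r ^ e"
      using r by (intro one_le_power)
    ultimately have "r ^ m s * \<bar>poly (P s) (u / r)\<bar> * \<bar>u\<bar> ^ a s * 1 \<le> r ^ m s * B * r ^ a s * r ^ e"
      using r B by (intro mult_mono) auto
    then show ?thesis
      using r by (simp add: r_def[symmetric] add.commute[of "u\<^sup>2"] abs_mult power_abs N_def power_add mult_ac)
  qed
  have c_eq: "?c = (LBINT t:{-1..1}. poly (P s * monom 1 (a s)) t * (1 - t\<^sup>2) powr ((real e - 1) / 2))"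
  proof -
    have "?f u 1 / sqrt (1 + u\<^sup>2) ^ (N + 2) =
      poly (P s * monom 1 (a s)) (u / sqrt (1 + u\<^sup>2)) / sqrt (1 + u\<^sup>2) ^ (e + 2)" for u
    proof -
      define r where "r = sqrt (1 + u\<^sup>2)"
      have r: "r \<noteq> 0"
        by (simp add: r_def add_nonneg_eq_0_iff)
      then show ?thesis
        by (simp add: r_def[symmetric] add.commute[of "u\<^sup>2"] N_def power_add poly_monom power_divide)
    qed
    then show ?thesis
      using integral_cot_eq_gegenbauer[OF e1, of "P s * monom 1 (a s)"] by simp
  qed
  show ?case
    unfolding exp
  proof (intro exI conjI ballI impI)
    show "c * ?c = 0" if deg: "\<exists>k\<in>{s..d - 1}. degenerate d m a k"
    proof (cases "\<exists>k\<in>{Suc s..d - 1}. degenerate d m a k")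
      case False
      have "degenerate d m a s"
        using deg False by (metis atLeastAtMost_iff le_antisym not_less_eq_eq)
      moreover have "\<not> degenerate d m a (Suc s)"
        using False step.hyps by auto
      ultimately have nd: "sph_beta d m s \<le> (\<Sum>i = Suc s..d. a i)" "even (sph_beta d m s + (\<Sum>i = Suc s..d. a i))"
        and dg: "a s + (\<Sum>i = Suc s..d. a i) < m s + sph_beta d m s \<or>
          odd (m s + sph_beta d m s + (a s + (\<Sum>i = Suc s..d. a i)))"
        using step.hyps by (auto simp: degenerate_def sph_beta_def sum.distrib sum.atLeast_Suc_atMost[of s])
      then obtain q where q: "(\<Sum>i = Suc s..d. a i) = sph_beta d m s + 2 * q"
        by (metis add.assoc dvd_add_triv_left_iff le_Suc_ex mult_2 dvd_def even_add)
      have weight: "(real e - 1) / 2 = real q + sph_lambda d m s - 1 / 2"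
      proof -
        have "e = sph_beta d m s + (sph_beta d m s + 2 * q) + (d - Suc s)"
          using q by (simp add: e_def sum.distrib sph_beta_def)
        moreover have "real (d - Suc s) = real d - real s - 1"
          using step.hyps by (simp add: of_nat_diff)
        ultimately show ?thesis
          by (simp add: sph_lambda_def field_simps)
      qed
      have "sph_lambda d m s \<ge> 1 / 2"
      proof -
        have "real s + 2 \<le> real d"
          using s2 by auto
        then show ?thesis
          by (simp add: sph_lambda_def field_simps add_increasing2)
      qed
      moreover have "a s + 2 * q < m s \<or> odd (a s + m s)"
        using dg unfolding q by auto
      ultimately have "?c = 0"
        unfolding c_eq weight by (rule gegenbauer_moment_eq_0[OF geg[OF s2]])
      then show ?thesis
        by simp
    qed (use c0 in auto)
    fix \<Psi> :: "real \<Rightarrow> real"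
    assume \<Psi>[measurable]: "\<Psi> \<in> borel_measurable borel"
      and int: "set_integrable lborel {0<..} (\<lambda>t. \<Psi> t * t ^ Suc N)"
    let ?F = "\<lambda>x. \<Psi> (L2_set x {s..d}) * (solid_harm P d m s x * (\<Prod>i = s..d. x i ^ a i))"
    let ?\<Psi> = "\<lambda>t. \<integral>y. \<Psi> (sqrt (y\<^sup>2 + t\<^sup>2)) * ?h y t \<partial>lborel"
    have \<Psi>': "?\<Psi> t * t ^ e = (\<integral>y. \<Psi> (sqrt (y\<^sup>2 + t\<^sup>2)) * ?f y t \<partial>lborel)" for t
      by (simp add: mult.assoc[symmetric])
    have "integrable (Pi\<^sub>M {s..d} (\<lambda>_. lborel)) ?F"
      using int step.hyps by (intro integrable_solid_harm) (simp_all only: exp \<Psi> d less_imp_le)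
    then have "(\<integral>x. ?F x \<partial>Pi\<^sub>M {s..d} (\<lambda>_. lborel)) =
        (\<integral>x. \<integral>y. ?F (x(s := y)) \<partial>lborel \<partial>Pi\<^sub>M {Suc s..d} (\<lambda>_. lborel))"
      unfolding ins by (intro lborel_PiM.product_integral_insert) auto
    also have "\<dots> = (\<integral>x. ?\<Psi> (L2_set x {Suc s..d}) *
        (solid_harm P d m (Suc s) x * (\<Prod>i = Suc s..d. x i ^ a i)) \<partial>Pi\<^sub>M {Suc s..d} (\<lambda>_. lborel))"
      unfolding solid_harm_fun_upd[OF step.hyps(2)] mult.assoc[symmetric] integral_mult_left_zero ..
    also have "\<dots> = c * (LINT t:{0<..}|lborel. ?\<Psi> t * t ^ e)"
    proof (rule IH)
      show "set_integrable lborel {0<..} (\<lambda>t. ?\<Psi> t * t ^ e)"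
        unfolding \<Psi>' by (rule set_integrable_half_plane_radial[OF f \<Psi> hom bound int])
    qed measurable
    also have "(LINT t:{0<..}|lborel. ?\<Psi> t * t ^ e) = ?c * (LINT t:{0<..}|lborel. \<Psi> t * t ^ Suc N)"
      unfolding \<Psi>' by (rule set_integral_half_plane_radial[OF f \<Psi> hom bound int])
    finally show "(\<integral>x. ?F x \<partial>Pi\<^sub>M {s..d} (\<lambda>_. lborel)) =
      c * ?c * (LINT t:{0<..}|lborel. \<Psi> t * t ^ Suc N)"
      by (simp only: mult.assoc)
  qed
qed

section \<open>Polar coordinates\<close>

context
  fixes d :: nat and x :: "nat \<Rightarrow> real"
  assumes d: "2 \<le> d"
begin

lemma L2_set_tail_power2:
  assumes "i < d"
  shows "(L2_set x {i..d})\<^sup>2 = (x i)\<^sup>2 + (L2_set x {Suc i..d})\<^sup>2"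
proof -
  have "{i..d} = insert i {Suc i..d}"
    using assms by auto
  then show ?thesis
    by (simp add: add_nonneg_nonneg)
qed

lemma is_polar_exists: "\<exists>\<rho> \<theta>. is_polar d x \<rho> \<theta>"
proof -
  let ?r = "\<lambda>i. L2_set x {i..d}"
  have tail: "(?r (d - 1))\<^sup>2 = (x (d - 1))\<^sup>2 + (x d)\<^sup>2"
    using d L2_set_tail_power2[of "d - 1"] by simp
  obtain \<phi> where \<phi>: "0 \<le> \<phi>" "\<phi> < 2 * pi" "x (d - 1) = ?r (d - 1) * cos \<phi>" "x d = ?r (d - 1) * sin \<phi>"
  proof (cases "?r (d - 1) = 0")
    case True
    with tail have "x (d - 1) = 0" "x d = 0"
      by (simp_all add: sum_power2_eq_zero_iff)
    then show ?thesis
      using that[of 0] True by simp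
  next
    case False
    have "(x (d - 1) / ?r (d - 1))\<^sup>2 + (x d / ?r (d - 1))\<^sup>2 =
        ((x (d - 1))\<^sup>2 + (x d)\<^sup>2) / (?r (d - 1))\<^sup>2"
      by (simp add: power_divide add_divide_distrib)
    then have "(x (d - 1) / ?r (d - 1))\<^sup>2 + (x d / ?r (d - 1))\<^sup>2 = 1"
      unfolding tail[symmetric] using False by simp
    then obtain t where "0 \<le> t" "t < 2 * pi" "x (d - 1) / ?r (d - 1) = cos t" "x d / ?r (d - 1) = sin t"
      by (rule sincos_total_2pi) simp
    then show ?thesis
      using that[of t] False by (simp add: field_simps)
  qed
  define \<theta> where "\<theta> k = (if k = 1 then \<phi> else arccos (x (d - k) / ?r (d - k)))" for k
  have x_le: "\<bar>x i\<bar> \<le> ?r i" if "i \<le> d" for i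
    using that by (intro abs_le_L2_set) auto
  have quot: "\<bar>x i / ?r i\<bar> \<le> 1" if "i \<le> d" for i
    using x_le[OF that] by (auto simp: abs_divide divide_le_eq_1)
  have step: "x i = ?r i * cos (\<theta> (d - i))" "?r (Suc i) = ?r i * sin (\<theta> (d - i))"
    if i: "1 \<le> i" "i < d - 1" for i
  proof -
    have \<theta>: "\<theta> (d - i) = arccos (x i / ?r i)"
      using i by (auto simp: \<theta>_def)
    have q: "\<bar>x i / ?r i\<bar> \<le> 1"
      using i by (intro quot) simp
    then have q': "- 1 \<le> x i / ?r i" "x i / ?r i \<le> 1"
      by (simp_all only: abs_le_iff minus_le_iff)
    show "x i = ?r i * cos (\<theta> (d - i))"
      using x_le[of i] i q by (cases "?r i = 0") (auto simp: \<theta> cos_arccos_abs)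
    have "(?r i * sin (arccos (x i / ?r i)))\<^sup>2 = (?r i)\<^sup>2 * (1 - (x i / ?r i)\<^sup>2)"
      using q by (simp add: power_mult_distrib sin_squared_eq cos_arccos_abs)
    also have "\<dots> = (?r i)\<^sup>2 - (x i)\<^sup>2"
      using x_le[of i] i by (cases "?r i = 0") (auto simp: power_divide right_diff_distrib)
    also have "\<dots> = (?r (Suc i))\<^sup>2"
      using L2_set_tail_power2[of i] i by simp
    finally have sq: "(?r i * sin (arccos (x i / ?r i)))\<^sup>2 = (?r (Suc i))\<^sup>2" .
    have "sin (arccos (x i / ?r i)) \<ge> 0"
      using arccos[OF q'] by (intro sin_ge_zero) auto
    then have "0 \<le> ?r i * sin (arccos (x i / ?r i))"
      by (rule mult_nonneg_nonneg[OF L2_set_nonneg])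
    from power2_eq_imp_eq[OF sq this L2_set_nonneg]
    show "?r (Suc i) = ?r i * sin (\<theta> (d - i))"
      unfolding \<theta> by (rule sym)
  qed
  have prod: "?r 1 * (\<Prod>k = d - i + 1..d - 1. sin (\<theta> k)) = ?r i" if "1 \<le> i" "i \<le> d - 1" for i
    using that
  proof (induction i)
    case (Suc i)
    show ?case
    proof (cases "i = 0")
      case True
      then show ?thesis
        using d by simp
    next
      case False
      have "{d - Suc i + 1..d - 1} = insert (d - i) {d - i + 1..d - 1}"
        using Suc.prems False by auto
      then show ?thesis
        using Suc False step(2)[of i] by (simp add: mult_ac)
    qed
  qed simp
  have "is_polar d x (?r 1) \<theta>"
    unfolding is_polar_def
  proof (intro conjI ballI)
    show "0 \<le> \<theta> 1" "\<theta> 1 < 2 * pi"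
      using \<phi> by (simp_all add: \<theta>_def)
    fix k
    assume k: "k \<in> {2..d - 1}"
    then have "\<bar>x (d - k) / ?r (d - k)\<bar> \<le> 1"
      by (intro quot) simp
    then have "- 1 \<le> x (d - k) / ?r (d - k)" "x (d - k) / ?r (d - k) \<le> 1"
      by (simp_all only: abs_le_iff minus_le_iff)
    from arccos[OF this] show "0 \<le> \<theta> k" "\<theta> k \<le> pi"
      using k by (auto simp: \<theta>_def)
  next
    fix i
    assume "i \<in> {1..d}"
    then consider "1 \<le> i" "i < d - 1" | "i = d - 1" | "i = d"
      by force
    then show "x i = polar_point d (?r 1) \<theta> i"
    proof cases
      case 1
      then show ?thesis
        using prod[of i] step(1)[of i] by (simp add: polar_point_def)
    next
      case 2
      then show ?thesis
        using prod[of i] \<phi>(3) d by (simp add: polar_point_def \<theta>_def)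
    next
      case 3
      have "{1..d - 1} = insert 1 {2..d - 1}"
        using d by auto
      then show ?thesis
        using prod[of "d - 1"] \<phi>(4) d 3 by (simp add: polar_point_def \<theta>_def mult_ac numeral_2_eq_2)
    qed
  qed simp
  then show ?thesis
    by blast
qed

lemma is_polar_radii:
  assumes "is_polar d x \<rho> \<theta>"
  shows "\<rho> = L2_set x {1..d}"
    and "1 \<le> i \<Longrightarrow> i < d - 1 \<Longrightarrow> L2_set x {Suc i..d} = L2_set x {i..d} * sin (\<theta> (d - i))"
    and "1 \<le> i \<Longrightarrow> i \<le> d - 1 \<Longrightarrow> x i = L2_set x {i..d} * cos (\<theta> (d - i))"
    and "x d = L2_set x {d - 1..d} * sin (\<theta> 1)"
proof -
  define R where "R i = \<rho> * (\<Prod>k = d - i + 1..d - 1. sin (\<theta> k))" for i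
  have \<rho>: "\<rho> \<ge> 0" and \<theta>: "\<And>k. k \<in> {2..d - 1} \<Longrightarrow> 0 \<le> \<theta> k \<and> \<theta> k \<le> pi"
    and x: "\<And>i. i \<in> {1..d} \<Longrightarrow> x i = polar_point d \<rho> \<theta> i"
    using assms by (auto simp: is_polar_def)
  have R_Suc: "R (Suc i) = R i * sin (\<theta> (d - i))" if "1 \<le> i" "i < d" for i
  proof -
    have "{d - Suc i + 1..d - 1} = insert (d - i) {d - i + 1..d - 1}"
      using that by auto
    then show ?thesis
      by (simp add: R_def mult_ac)
  qed
  have x_R: "x i = R i * cos (\<theta> (d - i))" if "1 \<le> i" "i < d" for i
    using that x[of i] by (simp add: polar_point_def R_def)
  have x_d: "x d = R d"
    using x[of d] d by (simp add: polar_point_def R_def)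
  have sq: "(L2_set x {i..d})\<^sup>2 = (R i)\<^sup>2" if "i \<le> d" "1 \<le> i" for i
    using that
  proof (induction i rule: inc_induct)
    case (step i)
    then have "(L2_set x {i..d})\<^sup>2 = (R i * cos (\<theta> (d - i)))\<^sup>2 + (R i * sin (\<theta> (d - i)))\<^sup>2"
      using L2_set_tail_power2[of i] x_R[of i] R_Suc[of i] by simp
    also have "\<dots> = (R i)\<^sup>2 * ((cos (\<theta> (d - i)))\<^sup>2 + (sin (\<theta> (d - i)))\<^sup>2)"
      by (simp only: power_mult_distrib distrib_left)
    finally show ?case
      by simp
  qed (simp add: x_d)
  have R: "L2_set x {i..d} = R i" if "1 \<le> i" "i \<le> d - 1" for i
  proof (rule power2_eq_imp_eq)
    show "(L2_set x {i..d})\<^sup>2 = (R i)\<^sup>2"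
      using that by (intro sq) auto
    show "0 \<le> R i"
      unfolding R_def using that d
      by (intro mult_nonneg_nonneg \<rho> prod_nonneg ballI sin_ge_zero) (auto intro: \<theta>[THEN conjunct1] \<theta>[THEN conjunct2])
  qed simp
  show "\<rho> = L2_set x {1..d}"
    using R[of 1] d by (simp add: R_def)
  show "L2_set x {Suc i..d} = L2_set x {i..d} * sin (\<theta> (d - i))" if "1 \<le> i" "i < d - 1"
    using that R[of i] R[of "Suc i"] R_Suc[of i] by simp
  show "x i = L2_set x {i..d} * cos (\<theta> (d - i))" if "1 \<le> i" "i \<le> d - 1"
    using that R[of i] x_R[of i] d by simp
  show "x d = L2_set x {d - 1..d} * sin (\<theta> 1)"
    using R[of "d - 1"] R_Suc[of "d - 1"] x_d d by simp
qed

text \<open>Where \<open>L2_set x {k..d} = 0\<close> the angle is undetermined, but there the factor \<open>L2_set x {k..d} ^ m k\<close>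
  vanishes unless the Gegenbauer polynomial is constant.\<close>

lemma sph_harm_eq_solid_harm:
  assumes polar: "is_polar d x \<rho> \<theta>"
    and deg: "\<And>k. k \<in> {1..d - 2} \<Longrightarrow> degree (C (sph_lambda d m k) (m k)) = m k"
  shows "sph_harm C d m \<rho> \<theta> = solid_harm (\<lambda>k. C (sph_lambda d m k) (m k)) d m 1 x"
proof -
  let ?r = "\<lambda>i. L2_set x {i..d}"
  let ?p = "\<lambda>k. poly (C (sph_lambda d m k) (m k))"
  note radii = is_polar_radii[OF polar]
  have prod: "\<rho> ^ msize d m * (\<Prod>k = 1..K. sin (\<theta> (d - k)) ^ sph_beta d m k * ?p k (cos (\<theta> (d - k)))) =
    (\<Prod>k = 1..K. ?r k ^ m k * ?p k (x k / ?r k)) * ?r (Suc K) ^ sph_beta d m K" if "K \<le> d - 2" for K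
    using that
  proof (induction K)
    case 0
    then show ?case
      by (simp add: radii(1) msize_def sph_beta_def)
  next
    case (Suc K)
    let ?K = "Suc K"
    have K: "1 \<le> ?K" "?K < d - 1"
      using Suc.prems by auto
    have beta: "sph_beta d m K = m ?K + sph_beta d m ?K"
      using K by (simp add: sph_beta_def sum.atLeast_Suc_atMost[of ?K])
    have p: "?r ?K ^ m ?K * ?p ?K (cos (\<theta> (d - ?K))) = ?r ?K ^ m ?K * ?p ?K (x ?K / ?r ?K)"
    proof (cases "?r ?K = 0")
      case True
      show ?thesis
      proof (cases "m ?K = 0")
        case 0: True
        then obtain c where "C (sph_lambda d m ?K) (m ?K) = [:c:]"
          using deg[of ?K] Suc.prems by (metis K(1) atLeastAtMost_iff degree_eq_zeroE)
        then show ?thesis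
          by simp
      qed (use True in simp)
    next
      case False
      then show ?thesis
        using radii(3)[of ?K] K by simp
    qed
    have "\<rho> ^ msize d m * (\<Prod>k = 1..?K. sin (\<theta> (d - k)) ^ sph_beta d m k * ?p k (cos (\<theta> (d - k)))) =
      ((\<Prod>k = 1..K. ?r k ^ m k * ?p k (x k / ?r k)) * ?r ?K ^ sph_beta d m K) *
        (sin (\<theta> (d - ?K)) ^ sph_beta d m ?K * ?p ?K (cos (\<theta> (d - ?K))))"
      using Suc.IH K by (simp add: mult_ac)
    also have "\<dots> = (\<Prod>k = 1..K. ?r k ^ m k * ?p k (x k / ?r k)) *
        (?r ?K ^ m ?K * ?p ?K (cos (\<theta> (d - ?K)))) * (?r ?K * sin (\<theta> (d - ?K))) ^ sph_beta d m ?K"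
      by (simp add: beta power_add power_mult_distrib mult_ac)
    also have "\<dots> = (\<Prod>k = 1..?K. ?r k ^ m k * ?p k (x k / ?r k)) * ?r (Suc ?K) ^ sph_beta d m ?K"
      unfolding p radii(2)[OF K, symmetric] by simp
    finally show ?case .
  qed
  define n where "n = m (d - 1) + m d"
  have beta: "sph_beta d m (d - 2) = n" "Suc (d - 2) = d - 1"
  proof -
    have "{d - 2 + 1..d} = insert (d - 1) {d}" "d - 1 \<noteq> d"
      using d by auto
    then show "sph_beta d m (d - 2) = n"
      by (simp add: sph_beta_def n_def)
  qed (use d in simp)
  have "Complex (x (d - 1)) (x d) = complex_of_real (?r (d - 1)) * cis (\<theta> 1)"
    using radii(3)[of "d - 1"] radii(4) d by (simp add: complex_eq_iff)
  then have "Complex (x (d - 1)) (x d) ^ n = complex_of_real (?r (d - 1) ^ n) * cis (real n * \<theta> 1)"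
    by (simp only: power_mult_distrib Complex.DeMoivre of_real_power)
  then have circ: "circ_part (m d) (Complex (x (d - 1)) (x d) ^ n) =
      ?r (d - 1) ^ n * (if m d = 0 then cos (real n * \<theta> 1) else sin (real n * \<theta> 1))"
    by (simp add: circ_part_def)
  have "sph_harm C d m \<rho> \<theta> =
    (\<rho> ^ msize d m * (\<Prod>k = 1..d - 2. sin (\<theta> (d - k)) ^ sph_beta d m k * ?p k (cos (\<theta> (d - k))))) *
      (if m d = 0 then cos (real n * \<theta> 1) else sin (real n * \<theta> 1))"
    by (simp add: sph_harm_def n_def mult_ac)
  also have "\<dots> = solid_harm (\<lambda>k. C (sph_lambda d m k) (m k)) d m 1 x"
    unfolding prod[OF order_refl] beta solid_harm_def n_def[symmetric] circ by (simp only: mult.assoc)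
  finally show ?thesis .
qed

lemma ball_typeI_eq_solid_harm:
  assumes "\<And>k. k \<in> {1..d - 2} \<Longrightarrow> degree (C (sph_lambda d m k) (m k)) = m k"
  shows "ball_typeI C d p m x =
    poly p ((L2_set x {1..d})\<^sup>2) * solid_harm (\<lambda>k. C (sph_lambda d m k) (m k)) d m 1 x"
proof -
  obtain \<rho> \<theta> where polar: "polar_of d x = (\<rho>, \<theta>)"
    by (cases "polar_of d x")
  have "case polar_of d x of (\<rho>, \<theta>) \<Rightarrow> is_polar d x \<rho> \<theta>"
    unfolding polar_of_def using is_polar_exists
    by (intro someI_ex[of "\<lambda>(\<rho>, \<theta>). is_polar d x \<rho> \<theta>"]) auto
  then have "is_polar d x \<rho> \<theta>"
    by (simp add: polar)
  then show ?thesis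
    using sph_harm_eq_solid_harm[of \<rho> \<theta> C m] assms is_polar_radii(1)[of \<rho> \<theta>]
    by (simp add: ball_typeI_def polar)
qed

end

section \<open>Radial integrals and the main result\<close>

lemma tendsto_powr_zero_at_left_1:
  fixes f :: "real \<Rightarrow> real"
  assumes "isCont f 1" "f 1 = 0" "s > 0" "\<And>t. 0 < t \<Longrightarrow> t < 1 \<Longrightarrow> 0 \<le> f t"
  shows "((\<lambda>t. f t powr s) \<longlongrightarrow> 0) (at_left 1)"
proof -
  have "(f \<longlongrightarrow> 0) (at_left 1)"
    using assms(1,2) by (metis continuous_within filterlim_at_split isCont_def)
  moreover have "\<forall>\<^sub>F t in at_left 1. 0 \<le> f t"
    using eventually_at_left_real[OF zero_less_one] by eventually_elim (use assms(4) in auto)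
  ultimately have "((\<lambda>t. f t powr s) \<longlongrightarrow> 0 powr s) (at_left 1)"
    using assms(3) by (intro tendsto_powr2) auto
  then show ?thesis
    using assms(3) by simp
qed

lemma
  fixes \<mu> :: real
  assumes \<mu>: "\<mu> > -1"
  shows set_integrable_jacobi_weight: "set_integrable lborel {0<..<1} (\<lambda>t::real. (1 - t) powr \<mu>)"
    and set_integrable_radial_weight: "set_integrable lborel {0<..<1} (\<lambda>t::real. t * (1 - t\<^sup>2) powr \<mu>)"
proof -
  have ivl: "einterval 0 1 = {0<..<1::real}"
    by (simp add: zero_ereal_def one_ereal_def)
  define k where "k = 1 / (\<mu> + 1)"
  have k: "(\<mu> + 1) * k = 1"
    using \<mu> by (simp add: k_def)
  let ?F = "\<lambda>t::real. (1 - t) powr (\<mu> + 1) * - k"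
  have "set_integrable lborel (einterval 0 1) (\<lambda>t::real. (1 - t) powr \<mu>)"
  proof (rule interval_integral_FTC_nonneg[where F = ?F])
    fix t :: real
    assume "0 < ereal t" "ereal t < 1"
    then have t: "0 < t" "t < 1"
      by simp_all
    have "DERIV (\<lambda>t. 1 - t) t :> - 1"
      by (auto intro!: derivative_eq_intros)
    then have "DERIV (\<lambda>t. (1 - t) powr (\<mu> + 1)) t :> (\<mu> + 1) * (1 - t) powr (\<mu> + 1 - of_nat 1) * - 1"
      using t by (intro DERIV_fun_powr) auto
    then have "DERIV ?F t :> (\<mu> + 1) * (1 - t) powr (\<mu> + 1 - of_nat 1) * - 1 * - k"
      by (rule DERIV_cmult_right)
    also have "(\<mu> + 1) * (1 - t) powr (\<mu> + 1 - of_nat 1) * - 1 * - k = ((\<mu> + 1) * k) * (1 - t) powr \<mu>"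
      by simp
    finally show "DERIV ?F t :> (1 - t) powr \<mu>"
      by (simp only: k mult_1_left)
    show "isCont (\<lambda>t. (1 - t) powr \<mu>) t"
      using t by (intro continuous_intros) auto
  next
    show "((?F \<circ> real_of_ereal) \<longlongrightarrow> (1 - 0) powr (\<mu> + 1) * - k) (at_right 0)"
      unfolding zero_ereal_def ereal_tendsto_simps using \<mu> by (intro tendsto_intros) auto
    show "((?F \<circ> real_of_ereal) \<longlongrightarrow> 0 * - k) (at_left 1)"
      unfolding one_ereal_def ereal_tendsto_simps using \<mu>
      by (intro tendsto_intros tendsto_powr_zero_at_left_1) (auto intro!: continuous_intros)
  qed auto
  then show "set_integrable lborel {0<..<1} (\<lambda>t::real. (1 - t) powr \<mu>)"
    unfolding ivl .
  let ?G = "\<lambda>t::real. (1 - t\<^sup>2) powr (\<mu> + 1) * - (k / 2)"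
  have "set_integrable lborel (einterval 0 1) (\<lambda>t::real. t * (1 - t\<^sup>2) powr \<mu>)"
  proof (rule interval_integral_FTC_nonneg[where F = ?G])
    fix t :: real
    assume "0 < ereal t" "ereal t < 1"
    then have t: "0 < t" "t < 1" "t\<^sup>2 < 1"
      by (simp_all add: power_less_one_iff)
    have "DERIV (\<lambda>t. 1 - t\<^sup>2) t :> - (2 * t)"
      by (auto intro!: derivative_eq_intros)
    then have "DERIV (\<lambda>t. (1 - t\<^sup>2) powr (\<mu> + 1)) t :> (\<mu> + 1) * (1 - t\<^sup>2) powr (\<mu> + 1 - of_nat 1) * - (2 * t)"
      using t by (intro DERIV_fun_powr) auto
    then have "DERIV ?G t :> (\<mu> + 1) * (1 - t\<^sup>2) powr (\<mu> + 1 - of_nat 1) * - (2 * t) * - (k / 2)"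
      by (rule DERIV_cmult_right)
    also have "(\<mu> + 1) * (1 - t\<^sup>2) powr (\<mu> + 1 - of_nat 1) * - (2 * t) * - (k / 2) =
        ((\<mu> + 1) * k) * (t * (1 - t\<^sup>2) powr \<mu>)"
      by simp
    finally show "DERIV ?G t :> t * (1 - t\<^sup>2) powr \<mu>"
      by (simp only: k mult_1_left)
    show "isCont (\<lambda>t. t * (1 - t\<^sup>2) powr \<mu>) t"
      using t by (intro continuous_intros) auto
  next
    show "((?G \<circ> real_of_ereal) \<longlongrightarrow> (1 - 0\<^sup>2) powr (\<mu> + 1) * - (k / 2)) (at_right 0)"
      unfolding zero_ereal_def ereal_tendsto_simps using \<mu> by (intro tendsto_intros) auto
    show "((?G \<circ> real_of_ereal) \<longlongrightarrow> 0 * - (k / 2)) (at_left 1)"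
      unfolding one_ereal_def ereal_tendsto_simps using \<mu>
      by (intro tendsto_intros tendsto_powr_zero_at_left_1) (auto intro!: continuous_intros simp: power_le_one)
  qed auto
  then show "set_integrable lborel {0<..<1} (\<lambda>t::real. t * (1 - t\<^sup>2) powr \<mu>)"
    unfolding ivl .
qed

definition radial_profile :: "real poly \<Rightarrow> real \<Rightarrow> real \<Rightarrow> real" where
  "radial_profile p \<mu> t = indicator {..1} t * (poly p (t\<^sup>2) * (1 - t\<^sup>2) powr \<mu>)"

lemma measurable_radial_profile [measurable]: "radial_profile p \<mu> \<in> borel_measurable borel"
  unfolding radial_profile_def by measurable

lemma set_integrable_radial_profile:
  assumes "\<mu> > -1" "e \<ge> 1"
  shows "set_integrable lborel {0<..} (\<lambda>t. radial_profile p \<mu> t * t ^ e)"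
proof -
  obtain B where B: "B \<ge> 0" "\<And>t. \<bar>t\<bar> \<le> 1 \<Longrightarrow> \<bar>poly p t\<bar> \<le> B"
    using poly_bounded_unit_interval[of p] by blast
  have int: "integrable lborel (\<lambda>t. B * (indicator {0<..<1} t *\<^sub>R (t * (1 - t\<^sup>2) powr \<mu>)))"
    using set_integrable_radial_weight[OF assms(1)] by (intro integrable_mult_right) (simp add: set_integrable_def)
  show ?thesis
    unfolding set_integrable_def
  proof (rule Bochner_Integration.integrable_bound[OF int])
    show "AE t in lborel. norm (indicator {0<..} t *\<^sub>R (radial_profile p \<mu> t * t ^ e)) \<le>
        norm (B * (indicator {0<..<1} t *\<^sub>R (t * (1 - t\<^sup>2) powr \<mu>)))"
    proof (rule AE_I2)
      fix t :: real
      consider "t \<le> 0 \<or> t > 1" | "t = 1" | "0 < t" "t < 1"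
        by linarith
      then show "norm (indicator {0<..} t *\<^sub>R (radial_profile p \<mu> t * t ^ e)) \<le>
          norm (B * (indicator {0<..<1} t *\<^sub>R (t * (1 - t\<^sup>2) powr \<mu>)))"
      proof cases
        case 3
        have "\<bar>poly p (t\<^sup>2)\<bar> \<le> B"
          using 3 by (intro B) (auto simp: power_le_one)
        moreover have "t ^ e \<le> t ^ 1"
          using 3 assms(2) by (intro power_decreasing) auto
        ultimately have "\<bar>poly p (t\<^sup>2)\<bar> * t ^ e * (1 - t\<^sup>2) powr \<mu> \<le> B * t * (1 - t\<^sup>2) powr \<mu>"
          using 3 B by (intro mult_right_mono mult_mono) auto
        then show ?thesis
          using 3 B by (simp add: radial_profile_def abs_mult mult_ac)
      qed (auto simp: radial_profile_def indicator_def)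
    qed
  qed measurable
qed

lemma set_integral_radial_profile:
  assumes \<mu>: "\<mu> > -1" and \<alpha>: "\<alpha> \<ge> 0" and e: "real e = 2 * (real q + \<alpha>) + 1"
  shows "(LINT t:{0<..}|lborel. radial_profile p \<mu> t * t ^ e) =
    1 / 2 * (LBINT t:{0..1}. poly p t * t ^ q * t powr \<alpha> * (1 - t) powr \<mu>)"
proof -
  let ?f = "\<lambda>t. poly p t * t ^ q * t powr \<alpha> * (1 - t) powr \<mu>"
  let ?h = "\<lambda>t. 2 * (radial_profile p \<mu> t * t ^ e)"
  have ivl: "einterval 0 1 = {0<..<1::real}"
    by (simp add: zero_ereal_def one_ereal_def)
  have e1: "e \<ge> 1"
    using e \<alpha> by (simp flip: of_nat_le_iff[where 'a=real])
  have sub: "(2 * t) *\<^sub>R ?f (t\<^sup>2) = ?h t" if t: "t \<in> {0<..<1}" for t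
  proof -
    have "t ^ e = t powr real e"
      using t by (simp add: powr_realpow)
    also have "\<dots> = t powr (real (2 * q) + 2 * \<alpha> + 1)"
      by (simp add: e algebra_simps)
    also have "\<dots> = t ^ (2 * q) * (t powr 2) powr \<alpha> * t"
      using t unfolding powr_add powr_powr by (subst powr_realpow) auto
    finally have "t ^ e = (t\<^sup>2) ^ q * (t\<^sup>2) powr \<alpha> * t"
      using t by (simp add: power_mult)
    then show ?thesis
      using t by (simp add: radial_profile_def mult_ac)
  qed
  have int1: "set_integrable lborel (einterval 0 1) (\<lambda>t. (2 * t) *\<^sub>R ?f (t\<^sup>2))"
  proof -
    have "set_integrable lborel {0<..} ?h"
      using set_integrable_radial_profile[OF \<mu> e1, of p] by simp
    then have "set_integrable lborel {0<..<1} ?h"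
      by (rule set_integrable_subset) auto
    moreover have "set_integrable lborel {0<..<1} ?h \<longleftrightarrow> set_integrable lborel {0<..<1} (\<lambda>t. (2 * t) *\<^sub>R ?f (t\<^sup>2))"
      by (rule set_integrable_cong) (use sub in simp_all)
    ultimately show ?thesis
      unfolding ivl by blast
  qed
  have int2: "set_integrable lborel (einterval 0 1) ?f"
    unfolding ivl
  proof -
    obtain B where B: "B \<ge> 0" "\<And>t. \<bar>t\<bar> \<le> 1 \<Longrightarrow> \<bar>poly p t\<bar> \<le> B"
      using poly_bounded_unit_interval[of p] by blast
    have "set_integrable lborel {0<..<1} (\<lambda>t. B * (1 - t) powr \<mu>)"
      using set_integrable_jacobi_weight[OF \<mu>] by simp
    then show "set_integrable lborel {0<..<1} ?f"
    proof (rule set_integrable_bound)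
      show "set_borel_measurable lborel {0<..<1} ?f"
        unfolding set_borel_measurable_def by measurable
      show "AE t in lborel. t \<in> {0<..<1} \<longrightarrow> norm (?f t) \<le> norm (B * (1 - t) powr \<mu>)"
      proof (intro AE_I2 impI)
        fix t :: real
        assume t: "t \<in> {0<..<1}"
        have "t powr \<alpha> \<le> 1"
          using powr_mono2[of \<alpha> t 1] t \<alpha> by simp
        moreover have "t ^ q \<le> 1"
          using t by (intro power_le_one) auto
        ultimately have "\<bar>poly p t\<bar> * t ^ q * t powr \<alpha> \<le> B * 1 * 1"
          using t B by (intro mult_mono) auto
        then have "\<bar>poly p t\<bar> * t ^ q * t powr \<alpha> * (1 - t) powr \<mu> \<le> B * (1 - t) powr \<mu>"
          by (intro mult_right_mono) auto
        then show "norm (?f t) \<le> norm (B * (1 - t) powr \<mu>)"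
          using t B by (simp add: abs_mult power_abs)
      qed
    qed
  qed
  have "(LBINT t:{0..1}. ?f t) = (LBINT t=0..1. ?f t)"
    by (simp add: interval_integral_Icc zero_ereal_def one_ereal_def)
  also have "\<dots> = (LBINT t=0..1. (2 * t) *\<^sub>R ?f (t\<^sup>2))"
  proof (rule interval_integral_substitution_integrable[OF _ _ _ _ _ _ _ int1 int2])
    fix t :: real
    assume "0 < ereal t" "ereal t < 1"
    then have t: "0 < t" "t < 1" "t\<^sup>2 < 1"
      by (simp_all add: power_less_one_iff)
    show "DERIV (\<lambda>t. t\<^sup>2) t :> 2 * t"
      by (auto intro!: derivative_eq_intros)
    show "isCont ?f (t\<^sup>2)"
      using t by (intro continuous_intros) auto
    show "isCont (\<lambda>t. 2 * t) t"
      by (intro continuous_intros)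
  next
    have "((\<lambda>t::real. ereal (t\<^sup>2)) \<longlongrightarrow> ereal (0\<^sup>2)) (at_right 0)" "((\<lambda>t::real. ereal (t\<^sup>2)) \<longlongrightarrow> ereal (1\<^sup>2)) (at_left 1)"
      by (intro tendsto_intros)+
    then show "((ereal \<circ> (\<lambda>t. t\<^sup>2) \<circ> real_of_ereal) \<longlongrightarrow> 0) (at_right 0)"
      "((ereal \<circ> (\<lambda>t. t\<^sup>2) \<circ> real_of_ereal) \<longlongrightarrow> 1) (at_left 1)"
      unfolding zero_ereal_def one_ereal_def ereal_tendsto_simps by (simp_all add: comp_def)
  qed auto
  also have "\<dots> = (LBINT t:{0<..<1}. (2 * t) *\<^sub>R ?f (t\<^sup>2))"
    by (simp add: interval_lebesgue_integral_def ivl)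
  also have "\<dots> = (LBINT t:{0<..<1}. ?h t)"
    using sub by (intro set_lebesgue_integral_cong) auto
  also have "\<dots> = 2 * (LINT t:{0<..<1}|lborel. radial_profile p \<mu> t * t ^ e)"
    by simp
  also have "(LINT t:{0<..<1}|lborel. radial_profile p \<mu> t * t ^ e) =
      (LINT t:{0<..}|lborel. radial_profile p \<mu> t * t ^ e)"
    unfolding set_lebesgue_integral_def
  proof (rule Bochner_Integration.integral_cong)
    show "indicator {0<..<1} t *\<^sub>R (radial_profile p \<mu> t * t ^ e) =
        indicator {0<..} t *\<^sub>R (radial_profile p \<mu> t * t ^ e)" for t
      by (cases "t = 1") (auto simp: radial_profile_def indicator_def)
  qed simp
  finally show ?thesis
    by simp
qed

lemma integral_ball_typeI:
  fixes C :: "real \<Rightarrow> nat \<Rightarrow> real poly" and a m :: "nat \<Rightarrow> nat"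
  assumes d: "2 \<le> d"
    and geg: "\<And>k. k \<in> {1..d - 2} \<Longrightarrow> is_gegenbauer (sph_lambda d m k) (m k) (C (sph_lambda d m k) (m k))"
  defines "e \<equiv> (\<Sum>i = 1..d. m i + a i) + (d - 1)"
    and "f \<equiv> \<lambda>p \<mu> x. ball_typeI C d p m x * monomial_fun d a x * ball_weight d \<mu> x"
  shows "\<exists>c. (\<forall>p. \<forall>\<mu> > -1. set_integrable (leb d) (unit_ball d) (f p \<mu>) \<and>
      (LINT x:unit_ball d|leb d. f p \<mu> x) =
        ball_const d \<mu> * (c * (LINT t:{0<..}|lborel. radial_profile p \<mu> t * t ^ e))) \<and>
    ((\<exists>k\<in>{1..d - 1}. degenerate d m a k) \<longrightarrow> c = 0)"
proof -
  define P where "P k = C (sph_lambda d m k) (m k)" for k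
  have gegP: "is_gegenbauer (sph_lambda d m k) (m k) (P k)" if "k \<in> {1..d - 2}" for k
    using geg[OF that] by (simp add: P_def)
  have deg: "degree (C (sph_lambda d m k) (m k)) = m k" if "k \<in> {1..d - 2}" for k
    using geg[OF that] by (simp add: is_gegenbauer_def)
  have d1: "1 \<le> d - 1" and e1: "1 \<le> e"
    using d by (simp_all add: e_def)
  let ?g = "\<lambda>p \<mu> x. radial_profile p \<mu> (L2_set x {1..d}) * (solid_harm P d m 1 x * (\<Prod>i = 1..d. x i ^ a i))"
  obtain c where c: "\<And>\<Psi>. \<Psi> \<in> borel_measurable borel \<Longrightarrow> set_integrable lborel {0<..} (\<lambda>t. \<Psi> t * t ^ e) \<Longrightarrow>
      (\<integral>x. \<Psi> (L2_set x {1..d}) * (solid_harm P d m 1 x * (\<Prod>i = 1..d. x i ^ a i)) \<partial>Pi\<^sub>M {1..d} (\<lambda>_. lborel)) =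
        c * (LINT t:{0<..}|lborel. \<Psi> t * t ^ e)"
    and c0: "\<exists>k\<in>{1..d - 1}. degenerate d m a k \<Longrightarrow> c = 0"
    using integral_solid_harm[OF d order_refl d1 gegP, of a] unfolding e_def by blast
  have fg: "indicator (unit_ball d) x *\<^sub>R f p \<mu> x = ball_const d \<mu> * ?g p \<mu> x"
    if "x \<in> space (leb d)" for p \<mu> x
  proof -
    have "ball_typeI C d p m x = poly p ((L2_set x {1..d})\<^sup>2) * solid_harm P d m 1 x"
      unfolding P_def by (rule ball_typeI_eq_solid_harm[OF d]) (rule deg)
    then show ?thesis
      using that
      by (simp add: f_def monomial_fun_def ball_weight_def unit_ball_def radial_profile_def indicator_def)
  qed
  show ?thesis
  proof (intro exI conjI allI impI)
    show "c = 0" if "\<exists>k\<in>{1..d - 1}. degenerate d m a k"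
      using that by (rule c0)
    fix p :: "real poly" and \<mu> :: real
    assume \<mu>: "\<mu> > -1"
    note int = set_integrable_radial_profile[OF \<mu> e1, of p]
    have g: "integrable (leb d) (?g p \<mu>)"
      unfolding leb_def
      by (rule integrable_solid_harm[OF d d1 measurable_radial_profile]) (use int in \<open>simp add: e_def\<close>)
    have "integrable (leb d) (\<lambda>x. indicator (unit_ball d) x *\<^sub>R f p \<mu> x) \<longleftrightarrow>
        integrable (leb d) (\<lambda>x. ball_const d \<mu> * ?g p \<mu> x)"
      by (intro Bochner_Integration.integrable_cong refl fg)
    then show "set_integrable (leb d) (unit_ball d) (f p \<mu>)"
      unfolding set_integrable_def using g by simp
    have "(LINT x:unit_ball d|leb d. f p \<mu> x) = (\<integral>x. ball_const d \<mu> * ?g p \<mu> x \<partial>leb d)"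
      unfolding set_lebesgue_integral_def by (intro Bochner_Integration.integral_cong refl fg)
    also have "\<dots> = ball_const d \<mu> * (\<integral>x. ?g p \<mu> x \<partial>leb d)"
      by simp
    also have "(\<integral>x. ?g p \<mu> x \<partial>leb d) = c * (LINT t:{0<..}|lborel. radial_profile p \<mu> t * t ^ e)"
      unfolding leb_def by (rule c[OF measurable_radial_profile int])
    finally show "(LINT x:unit_ball d|leb d. f p \<mu> x) =
        ball_const d \<mu> * (c * (LINT t:{0<..}|lborel. radial_profile p \<mu> t * t ^ e))" .
  qed
qed

lemma ball_const_pos:
  assumes "\<mu> > -1"
  shows "ball_const d \<mu> > 0"
  unfolding ball_const_def using assms
  by (intro divide_pos_pos mult_pos_pos Gamma_real_pos) (auto simp: add_pos_nonneg)

theorem proposition16: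
  fixes d r :: nat and \<mu> :: "nat \<Rightarrow> real" and n j a m :: "nat \<Rightarrow> nat"
    and C :: "real \<Rightarrow> nat \<Rightarrow> real poly" and A :: "nat \<Rightarrow> real poly"
  defines "S \<equiv> \<lambda>F. \<Sum>l = 1..r. ball_inner d (\<mu> l) (F l) (monomial_fun d a)"
    and "I \<equiv> \<lambda>F. LINT x:unit_ball d|leb d.
                  (\<Sum>l = 1..r. F l x * monomial_fun d a x * ball_weight d (\<mu> l) x)"
    and "F \<equiv> \<lambda>l. ball_typeI C d (A l) m"
    and "G \<equiv> \<lambda>l. ball_typeI_norm C d (\<mu> l) (A l) m"
  assumes "d \<ge> 2"
    and "\<forall>l\<in>{1..r}. \<mu> l > -1"
    and "\<forall>i\<in>{1..r}. \<forall>k\<in>{1..r}. i \<noteq> k \<longrightarrow> \<mu> i - \<mu> k \<notin> \<int>"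
    and "real (msize r j) \<le> real (msize r n) / 2"
    and "msize d m = msize r n - 2 * msize r j"
    and "m d \<in> {0, 1}"
    and "\<And>lam k. lam > 0 \<Longrightarrow> is_gegenbauer lam k (C lam k)"
    and "jacobi_pineiro_typeI r (real (msize d m) + (real d - 2) / 2) \<mu> j A"
  shows "S F = I F \<and> S G = I G \<and>
         (real (msize d a) < real (msize r n) - 2 \<longrightarrow> I G = 0) \<and>
         ((\<exists>k\<in>{1..d - 1}. (\<Sum>i = d - k..d. a i) < (\<Sum>i = d - k..d. m i) \<or>
              ((\<Sum>i = d - k..d. m i) < (\<Sum>i = d - k..d. a i) \<and>
               odd ((\<Sum>i = d - k..d. a i) - (\<Sum>i = d - k..d. m i)))) \<longrightarrow>
           I F = 0 \<and> I G = 0)"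
proof -
  note d = \<open>d \<ge> 2\<close>
  have \<mu>: "\<mu> l > -1" if "l \<in> {1..r}" for l
    using assms(6) that by blast
  define e where "e = (\<Sum>i = 1..d. m i + a i) + (d - 1)"
  let ?f = "\<lambda>l x. ball_typeI C d (A l) m x * monomial_fun d a x * ball_weight d (\<mu> l) x"
  let ?J = "\<lambda>l. LINT t:{0<..}|lborel. radial_profile (A l) (\<mu> l) t * t ^ e"
  have "is_gegenbauer (sph_lambda d m k) (m k) (C (sph_lambda d m k) (m k))" if "k \<in> {1..d - 2}" for k
  proof -
    have "real k + 2 \<le> real d"
      using that d by auto
    then have "sph_lambda d m k > 0"
      by (simp add: sph_lambda_def add_nonneg_pos)
    then show ?thesis
      using assms by blast
  qed
  then obtain c where
    c: "\<And>p \<mu>. \<mu> > -1 \<Longrightarrow> set_integrable (leb d) (unit_ball d)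
        (\<lambda>x. ball_typeI C d p m x * monomial_fun d a x * ball_weight d \<mu> x) \<and>
      (LINT x:unit_ball d|leb d. ball_typeI C d p m x * monomial_fun d a x * ball_weight d \<mu> x) =
        ball_const d \<mu> * (c * (LINT t:{0<..}|lborel. radial_profile p \<mu> t * t ^ e))"
    and c0: "\<exists>k\<in>{1..d - 1}. degenerate d m a k \<Longrightarrow> c = 0"
    using integral_ball_typeI[OF d, of m C a] unfolding e_def by blast
  have scaled: "S E = I E" "I E = c * (\<Sum>l = 1..r. \<kappa> l * (ball_const d (\<mu> l) * ?J l))"
    if E: "\<And>l x. E l x = \<kappa> l * ball_typeI C d (A l) m x" for E \<kappa>
  proof -
    have int: "integrable (leb d) (\<lambda>x. indicator (unit_ball d) x *\<^sub>R (E l x * monomial_fun d a x * ball_weight d (\<mu> l) x))"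
      and val: "(LINT x:unit_ball d|leb d. E l x * monomial_fun d a x * ball_weight d (\<mu> l) x) =
        \<kappa> l * (ball_const d (\<mu> l) * (c * ?J l))"
      if "l \<in> {1..r}" for l
    proof -
      have eq: "E l x * monomial_fun d a x * ball_weight d (\<mu> l) x = \<kappa> l * ?f l x" for x
        by (simp add: E)
      show "integrable (leb d) (\<lambda>x. indicator (unit_ball d) x *\<^sub>R (E l x * monomial_fun d a x * ball_weight d (\<mu> l) x))"
        using c[OF \<mu>[OF that], of "A l"] unfolding eq set_integrable_def[symmetric]
        by (intro set_integrable_mult_right) simp
      show "(LINT x:unit_ball d|leb d. E l x * monomial_fun d a x * ball_weight d (\<mu> l) x) =
          \<kappa> l * (ball_const d (\<mu> l) * (c * ?J l))"
        using c[OF \<mu>[OF that], of "A l"] unfolding eq by simp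
    qed
    show SI: "S E = I E"
      unfolding S_def I_def ball_inner_def set_lebesgue_integral_def scaleR_sum_right
      by (rule Bochner_Integration.integral_sum[symmetric]) (rule int)
    show "I E = c * (\<Sum>l = 1..r. \<kappa> l * (ball_const d (\<mu> l) * ?J l))"
      unfolding SI[symmetric] S_def ball_inner_def sum_distrib_left
      by (rule sum.cong[OF refl], subst val) (simp_all only: mult_ac)
  qed
  have F: "F l x = 1 * ball_typeI C d (A l) m x" for l x
    by (simp add: F_def)
  have G: "G l x = 1 / ball_const d (\<mu> l) * ball_typeI C d (A l) m x" for l x
    by (simp add: G_def ball_typeI_norm_def)
  note FI = scaled[of F "\<lambda>_. 1", OF F] and GI = scaled[of G "\<lambda>l. 1 / ball_const d (\<mu> l)", OF G]
  have IG: "I G = c * (\<Sum>l = 1..r. ?J l)"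
    unfolding GI(2) using ball_const_pos[OF \<mu>] by (intro arg_cong[where f="(*) c"] sum.cong) (auto simp: less_imp_neq[symmetric])
  have "I G = 0" if a: "real (msize d a) < real (msize r n) - 2"
  proof (cases "degenerate d m a 1")
    case True
    then have "c = 0"
      using d by (intro c0 bexI[of _ 1]) auto
    then show ?thesis
      by (simp add: IG)
  next
    case False
    then have nd: "msize d m \<le> msize d a" "even (msize d m + msize d a)"
      by (auto simp: degenerate_def msize_def sum.distrib)
    then obtain q where q: "msize d a = msize d m + 2 * q"
      by (metis add.assoc dvd_add_triv_left_iff le_Suc_ex mult_2 dvd_def even_add)
    have size: "q + 1 < msize r j"
      using a q assms(8,9) by linarith
    have exponent: "real e = 2 * (real q + (real (msize d m) + (real d - 2) / 2)) + 1"
    proof -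
      have "e = 2 * msize d m + 2 * q + (d - 1)"
        using q by (simp add: e_def msize_def sum.distrib)
      then show ?thesis
        using d by (simp add: of_nat_diff field_simps)
    qed
    have "?J l = 1 / 2 * (LBINT t:{0..1}. poly (A l) t * t ^ q * t powr (real (msize d m) + (real d - 2) / 2) * (1 - t) powr \<mu> l)"
      if "l \<in> {1..r}" for l
      using d by (intro set_integral_radial_profile[OF \<mu>[OF that] _ exponent]) simp
    then have "(\<Sum>l = 1..r. ?J l) = 1 / 2 * (\<Sum>l = 1..r. LBINT t:{0..1}.
        poly (A l) t * t ^ q * t powr (real (msize d m) + (real d - 2) / 2) * (1 - t) powr \<mu> l)"
      unfolding sum_distrib_left by (intro sum.cong refl)
    also have "\<dots> = 0"
      using assms(12) size unfolding jacobi_pineiro_typeI_def by auto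
    finally show ?thesis
      by (simp add: IG)
  qed
  moreover have "I F = 0 \<and> I G = 0"
    if ex: "\<exists>k\<in>{1..d - 1}. (\<Sum>i = d - k..d. a i) < (\<Sum>i = d - k..d. m i) \<or>
      ((\<Sum>i = d - k..d. m i) < (\<Sum>i = d - k..d. a i) \<and>
       odd ((\<Sum>i = d - k..d. a i) - (\<Sum>i = d - k..d. m i)))"
  proof -
    from ex obtain k where k: "k \<in> {1..d - 1}"
      and deg: "(\<Sum>i = d - k..d. a i) < (\<Sum>i = d - k..d. m i) \<or>
        ((\<Sum>i = d - k..d. m i) < (\<Sum>i = d - k..d. a i) \<and>
         odd ((\<Sum>i = d - k..d. a i) - (\<Sum>i = d - k..d. m i)))"
      by blast
    from deg have "degenerate d m a (d - k)"
      unfolding degenerate_def sum.distrib by auto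
    with k have "c = 0"
      by (intro c0 bexI[of _ "d - k"]) auto
    then show ?thesis
      by (simp add: FI(2) IG)
  qed
  ultimately show ?thesis
    using FI(1) GI(1) by blast
qed

end
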